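(* Let $\Omega\subset\mathbb{R}^N$ be open and bounded and $1<p<N$. Let $G_1,G_2:\Omega\times(0,\infty)\to[0,\infty)$ be Carathéodory functions such that $G_1(x,s)\le G_2(x,s)$ for almost every $x\in\Omega$ and all $s\in(0,\infty)$, and such that either $s\mapsto G_1(x,s)s^{1-p}$ or $s\mapsto G_2(x,s)s^{1-p}$ is (strictly) decreasing on $(0,\infty)$ for almost every $x\in\Omega$. Let $v_1$ be a weak solution of $-\Delta_p v=G_1(x,v)$, $v>0$ in $\Omega$, $v=0$ on $\partial\Omega$, and let $v_2$ be a weak solution of $-\Delta_p v=G_2(x,v)$, $v>0$ in $\Omega$, $v=0$ on $\partial\Omega$. Then $v_1\le v_2$ almost everywhere in $\Omega$.
   Context: $\Delta_p u=\operatorname{div}(|\nabla u|^{p-2}\nabla u)$. Given a Carathéodory function $F:\Omega\times(0,\infty)\to[0,\infty)$, a weak solution of the problem $-\Delta_p u=F(x,u)$ in $\Omega$, $u>0$ in $\Omega$, $u=0$ on $\partial\Omega$, is a function $u\in W^{1,p}_0(\Omega)$ with $u>0$ a.e. in $\Omega$, such that $F(x,u)\in L^1_{\rm loc}(\Omega)$ and $\int_\Omega|\nabla u|^{p-2}\nabla u\cdot\nabla\varphi=\int_\Omega F(x,u)\varphi$ for all $\varphi\in C^1_c(\Omega)$. *)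

theory Defs
  imports "HOL-Analysis.Analysis"
begin

definition grad :: "('a::euclidean_space \<Rightarrow> real) \<Rightarrow> 'a \<Rightarrow> 'a" where
  "grad f x = (SOME D. GDERIV f x :> D)"

definition Cc1 :: "'a::euclidean_space set \<Rightarrow> ('a \<Rightarrow> real) \<Rightarrow> bool" where
  "Cc1 \<Omega> \<phi> \<longleftrightarrow>
     (\<exists>D. (\<forall>x. GDERIV \<phi> x :> D x) \<and> continuous_on UNIV D) \<and>
     compact (closure {x. \<phi> x \<noteq> 0}) \<and> closure {x. \<phi> x \<noteq> 0} \<subseteq> \<Omega>"

text \<open>u belongs to W^{1,p}_0(Omega) with (weak) gradient g: u, g are in L^p(Omega) and
  (u, g) is the W^{1,p}-limit of (phi_k, grad phi_k) for test functions phi_k in C^1_c(Omega).\<close>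
definition W0 :: "real \<Rightarrow> 'a::euclidean_space set \<Rightarrow> ('a \<Rightarrow> real) \<Rightarrow> ('a \<Rightarrow> 'a) \<Rightarrow> bool" where
  "W0 p \<Omega> u g \<longleftrightarrow>
     u \<in> borel_measurable (lebesgue_on \<Omega>) \<and>
     integrable (lebesgue_on \<Omega>) (\<lambda>x. \<bar>u x\<bar> powr p) \<and>
     g \<in> borel_measurable (lebesgue_on \<Omega>) \<and>
     integrable (lebesgue_on \<Omega>) (\<lambda>x. norm (g x) powr p) \<and>
     (\<exists>\<phi>::nat \<Rightarrow> 'a \<Rightarrow> real. (\<forall>k. Cc1 \<Omega> (\<phi> k)) \<and>
        (\<lambda>k. \<integral>x. \<bar>\<phi> k x - u x\<bar> powr p \<partial>lebesgue_on \<Omega>) \<longlonglongrightarrow> 0 \<and>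
        (\<lambda>k. \<integral>x. norm (grad (\<phi> k) x - g x) powr p \<partial>lebesgue_on \<Omega>) \<longlonglongrightarrow> 0)"

definition caratheodory :: "'a::euclidean_space set \<Rightarrow> ('a \<Rightarrow> real \<Rightarrow> real) \<Rightarrow> bool" where
  "caratheodory \<Omega> F \<longleftrightarrow>
     (\<forall>x\<in>\<Omega>. \<forall>s>0. F x s \<ge> 0) \<and>
     (\<forall>s>0. (\<lambda>x. F x s) \<in> borel_measurable (lebesgue_on \<Omega>)) \<and>
     (AE x in lebesgue_on \<Omega>. continuous_on {0<..} (F x))"

definition weak_solution :: "real \<Rightarrow> 'a::euclidean_space set \<Rightarrow> ('a \<Rightarrow> real \<Rightarrow> real) \<Rightarrow> ('a \<Rightarrow> real) \<Rightarrow> bool" where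
  "weak_solution p \<Omega> F u \<longleftrightarrow>
     (\<exists>g. W0 p \<Omega> u g \<and>
        (AE x in lebesgue_on \<Omega>. u x > 0) \<and>
        (\<forall>K. compact K \<and> K \<subseteq> \<Omega> \<longrightarrow> integrable (lebesgue_on K) (\<lambda>x. F x (u x))) \<and>
        (\<forall>\<phi>. Cc1 \<Omega> \<phi> \<longrightarrow>
           (\<integral>x. norm (g x) powr (p - 2) * (g x \<bullet> grad \<phi> x) \<partial>lebesgue_on \<Omega>) =
           (\<integral>x. F x (u x) * \<phi> x \<partial>lebesgue_on \<Omega>)))"

end

(* Proof idea.  Let A(g) = |g|^(p-2) g and, for e > 0, put a = v1 + e, b = v2 + e,
   V = a / (1 + e a) (a bounded increasing truncation of a) and H = ((1 - b/V)^+)^2.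
   Test the equation of v1 with V^p a^(1-p) H and the equation of v2 with V^p b^(1-p) H.
   Without the truncation, convexity and monotonicity of the p-energy make
   A(grad v1) . grad(test1) - A(grad v2) . grad(test2) nonnegative (the Diaz-Saa/Picone
   inequality); the truncation costs at most p (1 - V/a) |grad v1|^p, which tends to 0 in L^1.
   As e tends to 0, Fatou's lemma yields
     integral of v1^p ((1 - v2/v1)^+)^2 (G1(x,v1) v1^(1-p) - G2(x,v2) v2^(1-p)) >= 0,
   while the integrand is negative wherever v1 > v2.

   These test functions are admissible without mollification: a C^1 function of the C^1_c
   approximants of v1 and v2 is again in C^1_c.  Along a dominated a.e. convergent subsequence Fatou's
   lemma gives one inequality between the two sides of the weak formulation; the other one follows
   because the first test function is bounded by v1 and v1 itself is admissible. *)

theory Submission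
  imports Defs
begin

section \<open>Convergence of integrals and pointwise inequalities\<close>

text \<open>The p-energy is convex as a functional of w = v^p, and perturbing w by \<eta> moves v in
  the direction \<eta> v^(1-p), up to a factor. Hence one common \<eta> = V^p H, divided by the
  respective (p-1)-st power, serves both equations; this is also how the quotients G(x,s) s^(1-p)
  enter. As H is a nondecreasing function of V/b alone, its derivative contributes, apart from the
  truncation and after Cauchy-Schwarz, a multiple of (X^(p-1) - Y^(p-1)) (X - Y) with X = |grad a|/a
  and Y = |grad b|/b. The shape of \<eta> is dictated by admissibility. Untruncated, the gradient of
  the second test function would contain (a/b)^(p-1) grad a with an unbounded factor; V \<le> 1/e
  and b \<ge> e bound it. The first test function carries the same V so that both expressions keep
  the weight V^p. The square makes H continuously differentiable, and H = 0 where v1 = 0, because V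
  \<le> e \<le> b there; this yields compact supports. The sources are only locally integrable, so
  integrability of their products with limits of test functions has to be extracted from the
  gradient side.\<close>

text \<open>Stated with a convergent bound \<open>c\<close> because the integrals of
  \<open>f n\<close> will be rewritten by the weak equation as quantities that converge by dominated
  convergence; integrability of the limit is then a conclusion.\<close>

lemma fatou_le:
  fixes f :: "nat \<Rightarrow> 'a \<Rightarrow> real"
  assumes int: "\<And>n. integrable M (f n)" and nonneg: "\<And>n. AE x in M. 0 \<le> f n x"
    and g [measurable]: "g \<in> borel_measurable M" and lim: "AE x in M. (\<lambda>n. f n x) \<longlonglongrightarrow> g x"
    and bound: "\<And>n. (\<integral>x. f n x \<partial>M) \<le> c n" and c: "c \<longlonglongrightarrow> C"
  shows "integrable M g" and "(\<integral>x. g x \<partial>M) \<le> C"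
proof -
  have [measurable]: "\<And>n. f n \<in> borel_measurable M" using int by auto
  have nonneg': "AE x in M. \<forall>n. 0 \<le> f n x" using nonneg by (simp add: AE_all_countable)
  have g0: "AE x in M. 0 \<le> g x" using lim nonneg'
    by eventually_elim (meson LIMSEQ_le_const)
  have "(\<integral>\<^sup>+x. ennreal (g x) \<partial>M) = (\<integral>\<^sup>+x. liminf (\<lambda>n. ennreal (f n x)) \<partial>M)"
  proof (rule nn_integral_cong_AE, use lim in eventually_elim)
    fix x assume "(\<lambda>n. f n x) \<longlonglongrightarrow> g x"
    then have "(\<lambda>n. ennreal (f n x)) \<longlonglongrightarrow> ennreal (g x)" by (rule tendsto_ennrealI)
    then show "ennreal (g x) = liminf (\<lambda>n. ennreal (f n x))"
      by (simp add: lim_imp_Liminf)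
  qed
  also have "\<dots> \<le> liminf (\<lambda>n. \<integral>\<^sup>+x. ennreal (f n x) \<partial>M)" by (rule nn_integral_liminf) simp
  also have "\<dots> \<le> liminf (\<lambda>n. ennreal (c n))"
    using bound by (intro Liminf_mono always_eventually allI)
      (simp add: nn_integral_eq_integral[OF int nonneg] ennreal_leI)
  also have "\<dots> = ennreal C"
    using tendsto_ennrealI[OF c] by (simp add: lim_imp_Liminf)
  finally have *: "(\<integral>\<^sup>+x. ennreal (g x) \<partial>M) \<le> ennreal C" .
  show I: "integrable M g"
    using * g0 by (intro integrableI_nonneg) (auto intro: le_less_trans)
  \<comment> \<open>\<open>ennreal\<close> sends negative numbers to 0, so the bound returns to the
    reals only once \<open>C\<close> is known to be nonnegative.\<close>
  have "0 \<le> c n" for n using order_trans[OF integral_nonneg_AE[OF nonneg] bound] .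
  then have "0 \<le> C" using c by (meson LIMSEQ_le_const)
  with * show "(\<integral>x. g x \<partial>M) \<le> C"
    by (simp add: nn_integral_eq_integral[OF I g0])
qed

text \<open>Indices with integrals below 2^-k make the sum of the chosen functions integrable. That
  sum is the majorant \<open>E\<close>, and its finiteness a.e. forces the terms to 0.\<close>

lemma dominated_subseq_of_L1_null:
  fixes f :: "nat \<Rightarrow> 'a \<Rightarrow> real"
  assumes int: "\<And>n. integrable M (f n)" and nonneg: "\<And>n x. 0 \<le> f n x"
    and null: "(\<lambda>n. \<integral>x. f n x \<partial>M) \<longlonglongrightarrow> 0"
  obtains r :: "nat \<Rightarrow> nat" and E where "AE x in M. (\<lambda>n. f (r n) x) \<longlonglongrightarrow> 0"
    "integrable M E" "\<And>n. AE x in M. f (r n) x \<le> E x"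
proof -
  have "\<exists>n. (\<integral>x. f n x \<partial>M) < (1/2)^k" for k :: nat
    using order_tendstoD(2)[OF null, of "(1/2)^k"] by (auto simp: eventually_sequentially)
  then obtain r where r: "\<And>k. (\<integral>x. f (r k) x \<partial>M) < (1/2)^k" by metis
  have [measurable]: "\<And>n. f n \<in> borel_measurable M" using int by auto
  have sumI: "summable (\<lambda>k. \<integral>x. norm (f (r k) x) \<partial>M)"
    by (rule summable_comparison_test[OF _ summable_geometric[of "1/2::real"]])
       (use r nonneg in \<open>auto intro!: exI[of _ 0] less_imp_le\<close>)
  have "(\<integral>\<^sup>+x. (\<Sum>k. ennreal (f (r k) x)) \<partial>M) = (\<Sum>k. ennreal (\<integral>x. f (r k) x \<partial>M))"
    by (subst nn_integral_suminf) (simp_all add: nn_integral_eq_integral[OF int] nonneg)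
  also have "\<dots> \<noteq> \<infinity>"
    using sumI unfolding infinity_ennreal_def
    by (intro ennreal_suminf_neq_top) (simp_all add: nonneg)
  finally have "AE x in M. (\<Sum>k. ennreal (f (r k) x)) \<noteq> \<infinity>"
    by (intro nn_integral_PInf_AE) auto
  then have sumx: "AE x in M. summable (\<lambda>k. f (r k) x)"
    by eventually_elim (rule summable_suminf_not_top, use nonneg in auto)
  show thesis
  proof (rule that)
    show "AE x in M. (\<lambda>n. f (r n) x) \<longlonglongrightarrow> 0"
      using sumx by eventually_elim (rule summable_LIMSEQ_zero)
    show "integrable M (\<lambda>x. \<Sum>k. f (r k) x)"
      by (rule integrable_suminf[OF int]) (use sumx sumI nonneg in auto)
    show "AE x in M. f (r n) x \<le> (\<Sum>k. f (r k) x)" for n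
      using sumx
    proof eventually_elim
      case (elim x)
      then show ?case using sum_le_suminf[of "\<lambda>k. f (r k) x" "{n}"] nonneg by auto
    qed
  qed
qed

section \<open>Elementary inequalities for powers and for the p-Laplacian flux\<close>

lemma powr_add_le:
  fixes x y p :: real
  assumes "0 \<le> x" "0 \<le> y" "0 \<le> p"
  shows "(x + y) powr p \<le> 2 powr p * (x powr p + y powr p)"
proof -
  have "(x + y) powr p \<le> (2 * max x y) powr p" using assms by (intro powr_mono2) auto
  also have "\<dots> = 2 powr p * max x y powr p" using assms by (simp add: powr_mult)
  also have "\<dots> \<le> 2 powr p * (x powr p + y powr p)"
    by (intro mult_left_mono) (auto simp: max_def)
  finally show ?thesis .
qed

lemma powr_mult_le_sum:
  fixes x y p :: real
  assumes "0 \<le> x" "0 \<le> y" "1 < p"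
  shows "x powr (p - 1) * y \<le> x powr p + y powr p"
proof -
  let ?m = "max x y"
  have "x powr (p - 1) * y \<le> ?m powr (p - 1) * ?m"
    using assms by (intro mult_mono powr_mono2) auto
  also have "\<dots> = ?m powr p"
    using assms by (cases "?m = 0") (auto simp: powr_diff)
  also have "\<dots> \<le> x powr p + y powr p" by (auto simp: max_def)
  finally show ?thesis .
qed

text \<open>For p < 2 the exponent p - 2 is negative; the convention \<open>0 powr r = 0\<close>
  makes the flux vanish at \<open>a = 0\<close>, so both claims persist there.\<close>

lemma norm_flux:
  fixes a b :: "'a::real_inner"
  assumes "1 < p"
  shows "norm a powr (p - 2) * (a \<bullet> a) = norm a powr p"
    and "\<bar>norm a powr (p - 2) * (a \<bullet> b)\<bar> \<le> norm a powr (p - 1) * norm b"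
proof -
  show "norm a powr (p - 2) * (a \<bullet> a) = norm a powr p"
    by (cases "a = 0") (auto simp: powr_diff dot_square_norm powr_numeral)
  have "\<bar>norm a powr (p - 2) * (a \<bullet> b)\<bar> \<le> norm a powr (p - 2) * (norm a * norm b)"
    by (simp add: abs_mult Cauchy_Schwarz_ineq2 mult_left_mono)
  also have "\<dots> = norm a powr (p - 1) * norm b"
    by (cases "a = 0") (auto simp: powr_diff powr_numeral power2_eq_square)
  finally show "\<bar>norm a powr (p - 2) * (a \<bullet> b)\<bar> \<le> norm a powr (p - 1) * norm b" .
qed

text \<open>Here \<open>x\<close> and \<open>y\<close> stand for \<open>|\<nabla>v\<^sub>1|/a\<close> and \<open>|\<nabla>v\<^sub>2|/b\<close>. The coefficient of \<open>h\<close> is controlled by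
  Young's inequality, that of \<open>k\<close> by monotonicity of \<open>x powr (p - 1)\<close>; \<open>1 - \<sigma>\<close> is the truncation error.\<close>

lemma picone_pointwise:
  fixes x y p \<sigma> h k :: real
  assumes x: "0 \<le> x" and y: "0 \<le> y" and p: "1 < p" and \<sigma>: "0 < \<sigma>" "\<sigma> \<le> 1"
    and h: "0 \<le> h" "h \<le> 1" and k: "0 \<le> k" "k \<le> 1"
  shows "(\<sigma> * (p * h + k) - (p - 1) * h) * x powr p - k * (x powr (p - 1) * y)
     - \<sigma> * (p * h + k) * (y powr (p - 1) * x) + ((p - 1) * h + k) * y powr p
     \<ge> - (p * (1 - \<sigma>) * x powr p)"
proof -
  have xp: "x powr p = x powr (p - 1) * x" if "0 \<le> x" for x :: real
    using that p by (cases "x = 0") (auto simp: powr_diff)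
  define X Y where "X = x powr (p - 1)" and "Y = y powr (p - 1)"
  have XY: "0 \<le> X" "0 \<le> Y" "x powr p = X * x" "y powr p = Y * y"
    by (auto simp: X_def Y_def xp x y)
  have mono: "0 \<le> (X - Y) * (x - y)"
    unfolding X_def Y_def using powr_mono2[of "p-1" x y] powr_mono2[of "p-1" y x] x y p
    by (cases "x \<le> y") (auto intro!: mult_nonneg_nonneg mult_nonpos_nonpos)
  \<comment> \<open>Young's inequality with exponents p/(p-1) and p, applied to \<open>Y\<close> and
    \<open>\<sigma> * x\<close>.\<close>
  have young: "p * (Y * (\<sigma> * x)) \<le> (p - 1) * (Y * y) + (\<sigma> * x) powr p"
  proof (cases "x = 0 \<or> y = 0")
    case True then show ?thesis using XY p by (auto simp: Y_def y)
  next
    case False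
    then have pos: "0 < \<sigma> * x" "0 < y" using \<sigma> x y by auto
    have "p * (1 - 1/p) = p - 1" using p by (simp add: field_simps)
    then have "y powr (p - 1) * (\<sigma> * x) = (y powr p) powr (1 - 1/p) * ((\<sigma>*x) powr p) powr (1/p)"
      using pos p by (simp add: powr_powr)
    also have "\<dots> \<le> (1 - 1/p) * y powr p + 1/p * (\<sigma>*x) powr p"
      by (rule Youngs_inequality_0) (use p pos in auto)
    finally show ?thesis using p XY(4) by (simp add: Y_def field_simps)
  qed
  have sx: "(\<sigma> * x) powr p \<le> \<sigma> * (X * x)"
  proof -
    have "\<sigma> powr p \<le> \<sigma> powr 1" using \<sigma> p by (intro powr_mono') auto
    then show ?thesis using x \<sigma> by (simp add: powr_mult XY(3)[symmetric] mult_right_mono)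
  qed
  have Xx: "0 \<le> X * x" using XY x by simp
  have Yx: "0 \<le> Y * x" using XY x by simp
  \<comment> \<open>The defect is \<sigma> - (p \<sigma> + 1 - p) = (p - 1)(1 - \<sigma>). Together
    with the defect 1 - \<sigma> of \<open>B2\<close> it adds up to the p (1 - \<sigma>) of the
    claim, since \<open>h\<close> and \<open>k\<close> are at most 1.\<close>
  have B1: "(p * \<sigma> + 1 - p) * (X * x) + (p - 1) * (Y * y) - p * (Y * (\<sigma> * x))
      \<ge> - ((p - 1) * (1 - \<sigma>) * (X * x))"
  proof -
    have "p * (Y * (\<sigma> * x)) \<le> (p - 1) * (Y * y) + \<sigma> * (X * x)"
      using young sx by linarith
    then show ?thesis by (simp add: algebra_simps)
  qed
  have B2: "\<sigma> * (X * x) - X * y + Y * y - \<sigma> * (Y * x) \<ge> - ((1 - \<sigma>) * (X * x))"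
  proof -
    have "0 \<le> (1 - \<sigma>) * (Y * x)" using \<sigma> Yx by simp
    with mono show ?thesis by (simp add: algebra_simps)
  qed
  have m1: "h * ((p - 1) * (1 - \<sigma>) * (X * x)) \<le> (p - 1) * (1 - \<sigma>) * (X * x)"
    using h \<sigma> p Xx by (intro mult_left_le_one_le) auto
  have m2: "k * ((1 - \<sigma>) * (X * x)) \<le> (1 - \<sigma>) * (X * x)"
    using k \<sigma> Xx by (intro mult_left_le_one_le) auto
  have n1: "h * ((p * \<sigma> + 1 - p) * (X * x) + (p - 1) * (Y * y) - p * (Y * (\<sigma> * x)))
      \<ge> - (h * ((p - 1) * (1 - \<sigma>) * (X * x)))"
    using mult_left_mono[OF B1 h(1)] by simp
  have n2: "k * (\<sigma> * (X * x) - X * y + Y * y - \<sigma> * (Y * x)) \<ge> - (k * ((1 - \<sigma>) * (X * x)))"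
    using mult_left_mono[OF B2 k(1)] by simp
  have "(\<sigma> * (p * h + k) - (p - 1) * h) * x powr p - k * (x powr (p - 1) * y)
     - \<sigma> * (p * h + k) * (y powr (p - 1) * x) + ((p - 1) * h + k) * y powr p
    = h * ((p * \<sigma> + 1 - p) * (X * x) + (p - 1) * (Y * y) - p * (Y * (\<sigma> * x)))
      + k * (\<sigma> * (X * x) - X * y + Y * y - \<sigma> * (Y * x))"
    unfolding XY(3,4) X_def[symmetric] Y_def[symmetric] by (simp add: algebra_simps)
  moreover have "p * (1 - \<sigma>) * x powr p = (p - 1) * (1 - \<sigma>) * (X * x) + (1 - \<sigma>) * (X * x)"
    unfolding XY(3) by (simp add: algebra_simps)
  ultimately show ?thesis using n1 n2 m1 m2 by linarith
qed

section \<open>Dominated approximation by test functions\<close>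

lemma grad_eq: "GDERIV f x :> D \<Longrightarrow> grad f x = D"
proof -
  assume D: "GDERIV f x :> D"
  have "E = D" if "GDERIV f x :> E" for E
  proof -
    have "(\<lambda>h. h \<bullet> E) = (\<lambda>h. h \<bullet> D)"
      using that D unfolding gderiv_def by (rule has_derivative_unique)
    then show ?thesis by (metis vector_eq_ldot)
  qed
  with D show ?thesis unfolding grad_def by (metis someI)
qed

lemma Cc1_grad:
  assumes "Cc1 \<Omega> \<phi>"
  shows "GDERIV \<phi> x :> grad \<phi> x" and "continuous_on S (grad \<phi>)" and "continuous_on S \<phi>"
proof -
  obtain D where D: "\<And>x. GDERIV \<phi> x :> D x" "continuous_on UNIV D"
    using assms unfolding Cc1_def by blast
  have "grad \<phi> = D" using grad_eq[OF D(1)] by auto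
  with D show "GDERIV \<phi> x :> grad \<phi> x" "continuous_on S (grad \<phi>)"
    by (auto intro: continuous_on_subset)
  show "continuous_on S \<phi>"
    using D(1) unfolding gderiv_def
    by (meson continuous_at_imp_continuous_on has_derivative_continuous)
qed

lemma Cc1_subsupport:
  assumes \<phi>: "Cc1 \<Omega> \<phi>" and "\<And>x. GDERIV f x :> D x" and "continuous_on UNIV D"
    and "\<And>x. \<phi> x = 0 \<Longrightarrow> f x = 0"
  shows "Cc1 \<Omega> f"
proof -
  have *: "closure {x. f x \<noteq> 0} \<subseteq> closure {x. \<phi> x \<noteq> 0}"
    using assms(4) by (intro closure_mono) auto
  then have "compact (closure {x. f x \<noteq> 0})"
    using \<phi> unfolding Cc1_def
    by (metis closed_closure compact_Int_closed inf.absorb_iff2)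
  with * show ?thesis using assms unfolding Cc1_def by blast
qed

lemma Cc1_bounded:
  assumes "Cc1 \<Omega> \<phi>"
  obtains B where "\<And>x. \<bar>\<phi> x\<bar> \<le> B" "\<And>x. norm (grad \<phi> x) \<le> B"
proof -
  let ?K = "closure {x. \<phi> x \<noteq> 0}"
  have K: "compact ?K" using assms unfolding Cc1_def by auto
  have "bounded (\<phi> ` ?K)" "bounded (grad \<phi> ` ?K)"
    by (intro compact_imp_bounded compact_continuous_image K Cc1_grad(2,3)[OF assms])+
  then obtain B1 B2 where B: "\<forall>x\<in>?K. \<bar>\<phi> x\<bar> \<le> B1" "\<forall>x\<in>?K. norm (grad \<phi> x) \<le> B2"
    unfolding bounded_iff ball_simps real_norm_def by (elim exE) (rule that)
  have out: "\<phi> x = 0 \<and> grad \<phi> x = 0" if x: "x \<notin> ?K" for x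
  proof -
    have z: "\<phi> y = 0" if "y \<in> - ?K" for y
      using that closure_subset[of "{x. \<phi> x \<noteq> 0}"] by blast
    have "(\<phi> has_derivative (\<lambda>h. h \<bullet> 0)) (at x)"
    proof (rule has_derivative_transform_within_open)
      show "((\<lambda>_. 0) has_derivative (\<lambda>h. h \<bullet> 0)) (at x)" by simp
      show "open (- ?K)" by (rule open_Compl[OF closed_closure])
    qed (use x z[symmetric] in blast)+
    then have "grad \<phi> x = 0" by (intro grad_eq) (simp add: gderiv_def)
    with z x show ?thesis by blast
  qed
  have "\<bar>\<phi> x\<bar> \<le> max 0 (max B1 B2) \<and> norm (grad \<phi> x) \<le> max 0 (max B1 B2)" for x
  proof (cases "x \<in> ?K")
    case True
    then have "\<bar>\<phi> x\<bar> \<le> B1" "norm (grad \<phi> x) \<le> B2" using B by blast+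
    then show ?thesis by (simp add: le_max_iff_disj)
  next
    case False
    with out[OF False] show ?thesis by simp
  qed
  then show thesis using that by blast
qed

lemma Cc1_measurable:
  assumes "Cc1 \<Omega> \<phi>" "open \<Omega>"
  shows "\<phi> \<in> borel_measurable (lebesgue_on \<Omega>)" "grad \<phi> \<in> borel_measurable (lebesgue_on \<Omega>)"
  by (rule continuous_imp_measurable_on_sets_lebesgue[OF Cc1_grad(3)[OF assms(1)]]
      continuous_imp_measurable_on_sets_lebesgue[OF Cc1_grad(2)[OF assms(1)]], use assms in simp)+

lemma bounded_integrable_powr:
  fixes f :: "'a::euclidean_space \<Rightarrow> 'b::euclidean_space"
  assumes "open \<Omega>" "bounded \<Omega>" "f \<in> borel_measurable (lebesgue_on \<Omega>)" "\<And>x. norm (f x) \<le> B" "0 < p"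
  shows "integrable (lebesgue_on \<Omega>) (\<lambda>x. norm (f x) powr p)"
proof -
  interpret finite_measure "lebesgue_on \<Omega>"
    using assms by (intro finite_measure_lebesgue_on lmeasurable_open)
  show ?thesis
    using assms by (intro integrable_const_bound[of _ "B powr p"]) (auto intro!: powr_mono2)
qed

text \<open>Squaring removes the kink of the positive part at 0; both \<open>pos_reg\<close> and
  \<open>excess\<close> rely on this.\<close>

lemma DERIV_max_0_power2: "((\<lambda>x::real. (max 0 x)\<^sup>2) has_real_derivative 2 * max 0 x) (at x)"
proof -
  consider "x > 0" | "x < 0" | "x = 0" by linarith
  then show ?thesis
  proof cases
    case 1
    have "((\<lambda>x. x\<^sup>2) has_real_derivative 2 * x) (at x)" by (auto intro!: derivative_eq_intros)
    then have "((\<lambda>x. (max 0 x)\<^sup>2) has_real_derivative 2 * x) (at x)"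
      by (rule has_field_derivative_transform_within_open[of _ _ _ "{0<..}"]) (use 1 in auto)
    with 1 show ?thesis by simp
  next
    case 2
    have "((\<lambda>x. 0) has_real_derivative 0) (at x)" by simp
    then have "((\<lambda>x. (max 0 x)\<^sup>2) has_real_derivative 0) (at x)"
      by (rule has_field_derivative_transform_within_open[of _ _ _ "{..<0}"]) (use 2 in auto)
    with 2 show ?thesis by simp
  next
    case 3
    have "((\<lambda>h::real. max 0 h) \<longlongrightarrow> max 0 0) (at 0)" by (intro tendsto_intros)
    moreover have "\<forall>\<^sub>F h::real in at 0. max 0 h = (max 0 h)\<^sup>2 / h"
      by (auto simp: eventually_at_filter power2_eq_square max_def)
    ultimately have "((\<lambda>h::real. (max 0 h)\<^sup>2 / h) \<longlongrightarrow> max 0 0) (at 0)"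
      by (rule Lim_transform_eventually)
    with 3 show ?thesis by (simp add: DERIV_def)
  qed
qed

text \<open>The derivative is two-sided, so \<open>P\<close> has to be defined near the closed quadrant; the condition
  on \<open>P 0\<close> makes \<open>P (\<phi> x) (\<psi> x)\<close> vanish outside the support of \<open>\<phi>\<close>.\<close>

definition C1_quadrant :: "(real \<Rightarrow> real \<Rightarrow> real) \<Rightarrow> (real \<Rightarrow> real \<Rightarrow> real) \<Rightarrow> (real \<Rightarrow> real \<Rightarrow> real) \<Rightarrow> bool" where
  "C1_quadrant P Ps Pt \<longleftrightarrow>
     (\<forall>s\<ge>0. \<forall>t\<ge>0. ((\<lambda>z. P (fst z) (snd z)) has_derivative (\<lambda>h. Ps s t * fst h + Pt s t * snd h)) (at (s, t))) \<and>
     continuous_on ({0..} \<times> {0..}) (\<lambda>z. Ps (fst z) (snd z)) \<and>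
     continuous_on ({0..} \<times> {0..}) (\<lambda>z. Pt (fst z) (snd z)) \<and>
     (\<exists>C. \<forall>s\<ge>0. \<forall>t\<ge>0. \<bar>Ps s t\<bar> \<le> C \<and> \<bar>Pt s t\<bar> \<le> C) \<and>
     (\<forall>s\<ge>0. \<forall>t\<ge>0. 0 \<le> P s t) \<and> (\<forall>t\<ge>0. P 0 t = 0) \<and>
     (\<lambda>z. P (fst z) (snd z)) \<in> borel_measurable borel \<and>
     (\<lambda>z. Ps (fst z) (snd z)) \<in> borel_measurable borel \<and>
     (\<lambda>z. Pt (fst z) (snd z)) \<in> borel_measurable borel"

lemma C1_quadrantD:
  assumes "C1_quadrant P Ps Pt"
  shows "0 \<le> s \<Longrightarrow> 0 \<le> t \<Longrightarrow>
      ((\<lambda>z. P (fst z) (snd z)) has_derivative (\<lambda>h. Ps s t * fst h + Pt s t * snd h)) (at (s, t))"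
    and "continuous_on ({0..} \<times> {0..}) (\<lambda>z. Ps (fst z) (snd z))"
    and "continuous_on ({0..} \<times> {0..}) (\<lambda>z. Pt (fst z) (snd z))"
    and "0 \<le> s \<Longrightarrow> 0 \<le> t \<Longrightarrow> 0 \<le> P s t"
    and "0 \<le> t \<Longrightarrow> P 0 t = 0"
  using assms unfolding C1_quadrant_def by (elim conjE; simp)+

lemma Cc1_comp:
  assumes P: "C1_quadrant P Ps Pt" and Cc: "Cc1 \<Omega> \<phi>" "Cc1 \<Omega> \<psi>" and nn: "\<And>x. 0 \<le> \<phi> x" "\<And>x. 0 \<le> \<psi> x"
  shows "Cc1 \<Omega> (\<lambda>x. P (\<phi> x) (\<psi> x))"
    and "grad (\<lambda>x. P (\<phi> x) (\<psi> x)) x = Ps (\<phi> x) (\<psi> x) *\<^sub>R grad \<phi> x + Pt (\<phi> x) (\<psi> x) *\<^sub>R grad \<psi> x"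
proof -
  have D: "GDERIV (\<lambda>x. P (\<phi> x) (\<psi> x)) x :> Ps (\<phi> x) (\<psi> x) *\<^sub>R grad \<phi> x + Pt (\<phi> x) (\<psi> x) *\<^sub>R grad \<psi> x" for x
  proof -
    have "((\<lambda>x. (\<phi> x, \<psi> x)) has_derivative (\<lambda>h. (h \<bullet> grad \<phi> x, h \<bullet> grad \<psi> x))) (at x)"
      using Cc1_grad(1)[OF Cc(1), of x] Cc1_grad(1)[OF Cc(2), of x] unfolding gderiv_def
      by (rule has_derivative_Pair)
    moreover have "((\<lambda>z. P (fst z) (snd z)) has_derivative
        (\<lambda>h. Ps (\<phi> x) (\<psi> x) * fst h + Pt (\<phi> x) (\<psi> x) * snd h)) (at (\<phi> x, \<psi> x))"
      by (intro C1_quadrantD(1)[OF P] nn)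
    ultimately have "((\<lambda>z. P (fst z) (snd z)) \<circ> (\<lambda>x. (\<phi> x, \<psi> x)) has_derivative
        (\<lambda>h. Ps (\<phi> x) (\<psi> x) * fst h + Pt (\<phi> x) (\<psi> x) * snd h) \<circ> (\<lambda>h. (h \<bullet> grad \<phi> x, h \<bullet> grad \<psi> x))) (at x)"
      by (rule diff_chain_at)
    then show ?thesis by (simp add: gderiv_def o_def inner_add_right)
  qed
  have cont: "continuous_on UNIV (\<lambda>x. (\<phi> x, \<psi> x))"
    by (intro continuous_intros Cc1_grad(3)[OF Cc(1)] Cc1_grad(3)[OF Cc(2)])
  have sub: "(\<lambda>x. (\<phi> x, \<psi> x)) ` UNIV \<subseteq> {0..} \<times> {0..}" using nn by auto
  have c: "continuous_on UNIV (\<lambda>x. Ps (\<phi> x) (\<psi> x))" "continuous_on UNIV (\<lambda>x. Pt (\<phi> x) (\<psi> x))"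
    using continuous_on_compose2[OF C1_quadrantD(2)[OF P] cont sub]
      continuous_on_compose2[OF C1_quadrantD(3)[OF P] cont sub] by simp_all
  show "Cc1 \<Omega> (\<lambda>x. P (\<phi> x) (\<psi> x))"
  proof (rule Cc1_subsupport[OF Cc(1) D])
    show "continuous_on UNIV (\<lambda>x. Ps (\<phi> x) (\<psi> x) *\<^sub>R grad \<phi> x + Pt (\<phi> x) (\<psi> x) *\<^sub>R grad \<psi> x)"
      by (intro continuous_intros c Cc1_grad(2)[OF Cc(1)] Cc1_grad(2)[OF Cc(2)])
    show "\<phi> x = 0 \<Longrightarrow> P (\<phi> x) (\<psi> x) = 0" for x
      using C1_quadrantD(5)[OF P, of "\<psi> x"] nn by simp
  qed
  show "grad (\<lambda>x. P (\<phi> x) (\<psi> x)) x = Ps (\<phi> x) (\<psi> x) *\<^sub>R grad \<phi> x + Pt (\<phi> x) (\<psi> x) *\<^sub>R grad \<psi> x"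
    by (rule grad_eq[OF D])
qed

text \<open>Only the gradients carry a majorant: flux integrals pass to the limit by dominated
  convergence, whereas integrals against the locally integrable source are treated by Fatou's lemma
  or with majorants of their own.\<close>

definition dom_approx :: "real \<Rightarrow> 'a::euclidean_space set \<Rightarrow> (nat \<Rightarrow> 'a \<Rightarrow> real) \<Rightarrow> ('a \<Rightarrow> real) \<Rightarrow> ('a \<Rightarrow> 'a) \<Rightarrow> bool" where
  "dom_approx p \<Omega> \<phi> u g \<longleftrightarrow>
     (\<forall>k. Cc1 \<Omega> (\<phi> k)) \<and> (\<forall>k x. 0 \<le> \<phi> k x) \<and>
     u \<in> borel_measurable (lebesgue_on \<Omega>) \<and> g \<in> borel_measurable (lebesgue_on \<Omega>) \<and>
     (AE x in lebesgue_on \<Omega>. (\<lambda>k. \<phi> k x) \<longlonglongrightarrow> u x \<and> (\<lambda>k. grad (\<phi> k) x) \<longlonglongrightarrow> g x) \<and>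
     (\<exists>E. integrable (lebesgue_on \<Omega>) E \<and>
        (AE x in lebesgue_on \<Omega>. \<forall>k. norm (grad (\<phi> k) x) powr p \<le> E x))"

lemma dom_approxD:
  assumes "dom_approx p \<Omega> \<phi> u g"
  shows "Cc1 \<Omega> (\<phi> k)" "0 \<le> \<phi> k x"
    "u \<in> borel_measurable (lebesgue_on \<Omega>)" "g \<in> borel_measurable (lebesgue_on \<Omega>)"
    "AE x in lebesgue_on \<Omega>. (\<lambda>k. \<phi> k x) \<longlonglongrightarrow> u x" "AE x in lebesgue_on \<Omega>. (\<lambda>k. grad (\<phi> k) x) \<longlonglongrightarrow> g x"
  using assms unfolding dom_approx_def by simp_all

lemma dom_approx_bound:
  assumes "dom_approx p \<Omega> \<phi> u g"
  obtains E where "integrable (lebesgue_on \<Omega>) E" "AE x in lebesgue_on \<Omega>. \<forall>k. norm (grad (\<phi> k) x) powr p \<le> E x"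
  using assms unfolding dom_approx_def by (elim conjE exE) (rule that)

lemma dom_approx_const:
  assumes "open \<Omega>" "bounded \<Omega>" "0 < p" "Cc1 \<Omega> \<phi>" "\<And>x. 0 \<le> \<phi> x"
  shows "dom_approx p \<Omega> (\<lambda>_. \<phi>) \<phi> (grad \<phi>)"
proof -
  obtain B where "\<And>x. norm (grad \<phi> x) \<le> B" using Cc1_bounded[OF assms(4)] by metis
  then have "integrable (lebesgue_on \<Omega>) (\<lambda>x. norm (grad \<phi> x) powr p)"
    using assms by (intro bounded_integrable_powr[where B=B] Cc1_measurable)
  then show ?thesis
    unfolding dom_approx_def using assms by (auto simp: Cc1_measurable)
qed

lemma tendsto_C1_quadrant:
  assumes P: "C1_quadrant P Ps Pt" and lim: "a \<longlonglongrightarrow> s" "b \<longlonglongrightarrow> t" and nn: "\<And>k. 0 \<le> a k" "\<And>k. 0 \<le> b k"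
  shows "(\<lambda>k::nat. P (a k) (b k)) \<longlonglongrightarrow> P s t" "(\<lambda>k. Ps (a k) (b k)) \<longlonglongrightarrow> Ps s t" "(\<lambda>k. Pt (a k) (b k)) \<longlonglongrightarrow> Pt s t"
proof -
  have st: "0 \<le> s" "0 \<le> t" using lim nn by (auto intro: LIMSEQ_le_const)
  have l: "(\<lambda>k. (a k, b k)) \<longlonglongrightarrow> (s, t)" by (intro tendsto_intros lim)
  have ev: "\<forall>\<^sub>F k in sequentially. (a k, b k) \<in> {0..} \<times> {0..}" using nn by simp
  have mem: "(s, t) \<in> {0..} \<times> {0..}" using st by simp
  have "isCont (\<lambda>z. P (fst z) (snd z)) (s, t)"
    by (rule has_derivative_continuous[OF C1_quadrantD(1)[OF P st]])
  from isCont_tendsto_compose[OF this l] show "(\<lambda>k. P (a k) (b k)) \<longlonglongrightarrow> P s t" by simp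
  note c = C1_quadrantD(2,3)[OF P]
  from continuous_on_tendsto_compose[OF c(1) l mem ev] continuous_on_tendsto_compose[OF c(2) l mem ev]
  show "(\<lambda>k. Ps (a k) (b k)) \<longlonglongrightarrow> Ps s t" "(\<lambda>k. Pt (a k) (b k)) \<longlonglongrightarrow> Pt s t" by simp_all
qed

lemma norm_comb_powr_le:
  fixes g h :: "'a::real_normed_vector"
  assumes "\<bar>\<alpha>\<bar> \<le> C" "\<bar>\<beta>\<bar> \<le> C" "norm g powr p \<le> E" "norm h powr p \<le> F" "0 < p"
  shows "norm (\<alpha> *\<^sub>R g + \<beta> *\<^sub>R h) powr p \<le> C powr p * (2 powr p * (E + F))"
proof -
  have C: "0 \<le> C" using assms by linarith
  have "norm (\<alpha> *\<^sub>R g + \<beta> *\<^sub>R h) \<le> \<bar>\<alpha>\<bar> * norm g + \<bar>\<beta>\<bar> * norm h"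
    using norm_triangle_ineq[of "\<alpha> *\<^sub>R g" "\<beta> *\<^sub>R h"] by simp
  also have "\<dots> \<le> C * (norm g + norm h)"
    using assms by (simp add: distrib_left add_mono mult_right_mono)
  finally have "norm (\<alpha> *\<^sub>R g + \<beta> *\<^sub>R h) powr p \<le> (C * (norm g + norm h)) powr p"
    using assms by (intro powr_mono2) auto
  also have "\<dots> = C powr p * (norm g + norm h) powr p" using C by (simp add: powr_mult)
  also have "\<dots> \<le> C powr p * (2 powr p * (norm g powr p + norm h powr p))"
    using assms by (intro mult_left_mono powr_add_le) auto
  also have "\<dots> \<le> C powr p * (2 powr p * (E + F))"
    using assms by (intro mult_left_mono add_mono) auto
  finally show ?thesis .
qed

lemma borel_measurable_comp2:
  assumes "(\<lambda>z. P (fst z) (snd z)) \<in> borel_measurable (borel :: (real \<times> real) measure)"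
    "u \<in> borel_measurable M" "v \<in> borel_measurable M"
  shows "(\<lambda>x. P (u x) (v x)) \<in> borel_measurable M"
proof -
  have "(\<lambda>x. (u x, v x)) \<in> borel_measurable M" using assms by (intro borel_measurable_Pair)
  from measurable_compose[OF this assms(1)] show ?thesis by simp
qed

text \<open>This replaces the Sobolev chain rule: the approximants are composed classically, the
  limit gradient follows by continuity, and bounded partial derivatives preserve an integrable
  majorant.\<close>

lemma dom_approx_comp:
  assumes P: "C1_quadrant P Ps Pt" and \<phi>: "dom_approx p \<Omega> \<phi> u g" and \<psi>: "dom_approx p \<Omega> \<psi> v h" and p: "0 < p"
  shows "dom_approx p \<Omega> (\<lambda>k x. P (\<phi> k x) (\<psi> k x)) (\<lambda>x. P (u x) (v x))
     (\<lambda>x. Ps (u x) (v x) *\<^sub>R g x + Pt (u x) (v x) *\<^sub>R h x)"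
proof -
  let ?M = "lebesgue_on \<Omega>"
  note Cc = dom_approxD(1)[OF \<phi>] dom_approxD(1)[OF \<psi>] and nn = dom_approxD(2)[OF \<phi>] dom_approxD(2)[OF \<psi>]
    and lim = dom_approxD(5,6)[OF \<phi>] dom_approxD(5,6)[OF \<psi>]
  obtain E where E: "integrable ?M E" "AE x in ?M. \<forall>k. norm (grad (\<phi> k) x) powr p \<le> E x"
    using dom_approx_bound[OF \<phi>] .
  obtain F where F: "integrable ?M F" "AE x in ?M. \<forall>k. norm (grad (\<psi> k) x) powr p \<le> F x"
    using dom_approx_bound[OF \<psi>] .
  obtain C where C: "\<forall>s\<ge>0. \<forall>t\<ge>0. \<bar>Ps s t\<bar> \<le> C \<and> \<bar>Pt s t\<bar> \<le> C"
    using P unfolding C1_quadrant_def by (elim conjE exE) (rule that)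
  have gr: "grad (\<lambda>x. P (\<phi> k x) (\<psi> k x)) x =
      Ps (\<phi> k x) (\<psi> k x) *\<^sub>R grad (\<phi> k) x + Pt (\<phi> k x) (\<psi> k x) *\<^sub>R grad (\<psi> k) x" for k x
    by (rule Cc1_comp(2)[OF P Cc nn])
  have m: "(\<lambda>x. P (u x) (v x)) \<in> borel_measurable ?M"
    "(\<lambda>x. Ps (u x) (v x)) \<in> borel_measurable ?M" "(\<lambda>x. Pt (u x) (v x)) \<in> borel_measurable ?M"
    using P dom_approxD(3)[OF \<phi>] dom_approxD(3)[OF \<psi>] borel_measurable_comp2[of P u ?M v]
      borel_measurable_comp2[of Ps u ?M v] borel_measurable_comp2[of Pt u ?M v]
    unfolding C1_quadrant_def by simp_all
  show ?thesis
    unfolding dom_approx_def gr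
  proof (intro conjI allI exI)
    show "Cc1 \<Omega> (\<lambda>x. P (\<phi> k x) (\<psi> k x))" for k by (rule Cc1_comp(1)[OF P Cc nn])
    show "0 \<le> P (\<phi> k x) (\<psi> k x)" for k x by (rule C1_quadrantD(4)[OF P nn])
    show "AE x in ?M. (\<lambda>k. P (\<phi> k x) (\<psi> k x)) \<longlonglongrightarrow> P (u x) (v x) \<and>
       (\<lambda>k. Ps (\<phi> k x) (\<psi> k x) *\<^sub>R grad (\<phi> k) x + Pt (\<phi> k x) (\<psi> k x) *\<^sub>R grad (\<psi> k) x)
       \<longlonglongrightarrow> Ps (u x) (v x) *\<^sub>R g x + Pt (u x) (v x) *\<^sub>R h x"
      using lim
    proof eventually_elim
      case (elim x)
      from tendsto_C1_quadrant[OF P elim(1,3) nn] elim show ?case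
        by (intro conjI tendsto_add tendsto_scaleR)
    qed
    show "integrable ?M (\<lambda>x. C powr p * (2 powr p * (E x + F x)))"
      using E F by auto
    show "AE x in ?M. \<forall>k. norm (Ps (\<phi> k x) (\<psi> k x) *\<^sub>R grad (\<phi> k) x + Pt (\<phi> k x) (\<psi> k x) *\<^sub>R grad (\<psi> k) x)
       powr p \<le> C powr p * (2 powr p * (E x + F x))"
      using E(2) F(2)
    proof eventually_elim
      case (elim x)
      then show ?case using C nn p by (intro allI norm_comb_powr_le) auto
    qed
  qed (intro m borel_measurable_add borel_measurable_scaleR dom_approxD(4)[OF \<phi>] dom_approxD(4)[OF \<psi>])+
qed

text \<open>\<open>powr_mult_le_sum\<close> supplies the majorant |G|^p + E for all \<open>k\<close>
  at once, in place of Hoelder's inequality.\<close>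

lemma dom_approx_flux:
  assumes \<phi>: "dom_approx p \<Omega> \<phi> u g" and p: "1 < p" and \<Omega>: "open \<Omega>"
    and [measurable]: "G \<in> borel_measurable (lebesgue_on \<Omega>)" and G: "integrable (lebesgue_on \<Omega>) (\<lambda>x. norm (G x) powr p)"
  shows "integrable (lebesgue_on \<Omega>) (\<lambda>x. norm (G x) powr (p - 2) * (G x \<bullet> g x))"
    and "(\<lambda>k. \<integral>x. norm (G x) powr (p - 2) * (G x \<bullet> grad (\<phi> k) x) \<partial>lebesgue_on \<Omega>)
       \<longlonglongrightarrow> (\<integral>x. norm (G x) powr (p - 2) * (G x \<bullet> g x) \<partial>lebesgue_on \<Omega>)"
proof -
  let ?M = "lebesgue_on \<Omega>"
  note [measurable] = dom_approxD(4)[OF \<phi>] and lim = dom_approxD(6)[OF \<phi>]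
  have [measurable]: "grad (\<phi> k) \<in> borel_measurable ?M" for k
    by (rule Cc1_measurable(2)[OF dom_approxD(1)[OF \<phi>] \<Omega>])
  obtain E where E: "integrable ?M E" "AE x in ?M. \<forall>k. norm (grad (\<phi> k) x) powr p \<le> E x"
    using dom_approx_bound[OF \<phi>] .
  have l: "AE x in ?M. (\<lambda>k. norm (G x) powr (p - 2) * (G x \<bullet> grad (\<phi> k) x))
      \<longlonglongrightarrow> norm (G x) powr (p - 2) * (G x \<bullet> g x)"
    using lim by eventually_elim (intro tendsto_intros)
  have b: "AE x in ?M. norm (norm (G x) powr (p - 2) * (G x \<bullet> grad (\<phi> k) x)) \<le> norm (G x) powr p + E x" for k
    using E(2)
  proof eventually_elim
    case (elim x)
    have "norm (norm (G x) powr (p - 2) * (G x \<bullet> grad (\<phi> k) x)) \<le> norm (G x) powr (p - 1) * norm (grad (\<phi> k) x)"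
      using norm_flux(2)[OF p] by simp
    also have "\<dots> \<le> norm (G x) powr p + norm (grad (\<phi> k) x) powr p"
      using p by (intro powr_mult_le_sum) auto
    finally show ?case using elim[rule_format, of k] by linarith
  qed
  have i: "integrable ?M (\<lambda>x. norm (G x) powr p + E x)" using G E by auto
  show "integrable ?M (\<lambda>x. norm (G x) powr (p - 2) * (G x \<bullet> g x))"
    by (rule integrable_dominated_convergence[OF _ _ i l b]) measurable
  show "(\<lambda>k. \<integral>x. norm (G x) powr (p - 2) * (G x \<bullet> grad (\<phi> k) x) \<partial>?M)
       \<longlonglongrightarrow> (\<integral>x. norm (G x) powr (p - 2) * (G x \<bullet> g x) \<partial>?M)"
    by (rule integral_dominated_convergence[OF _ _ i l b]) measurable
qed

text \<open>A \<open>C\<^sup>1\<close> approximation of the positive part; it turns the approximants provided by \<open>W0\<close>, which may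
  change sign, into nonnegative ones.\<close>

definition pos_reg :: "real \<Rightarrow> real \<Rightarrow> real" where
  "pos_reg e s = (max 0 s)\<^sup>2 / sqrt (s\<^sup>2 + e\<^sup>2)"

definition pos_reg_deriv :: "real \<Rightarrow> real \<Rightarrow> real" where
  "pos_reg_deriv e s = 2 * max 0 s / sqrt (s\<^sup>2 + e\<^sup>2) - (max 0 s)\<^sup>2 * s / sqrt (s\<^sup>2 + e\<^sup>2) ^ 3"

lemma sum_power2_pos: "0 < e \<Longrightarrow> 0 < s\<^sup>2 + e\<^sup>2" for s e :: real
  by (intro add_nonneg_pos) auto

lemma DERIV_pos_reg:
  assumes "0 < e"
  shows "(pos_reg e has_real_derivative pos_reg_deriv e s) (at s)"
proof -
  have pos: "0 < s\<^sup>2 + e\<^sup>2" using sum_power2_pos assms .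
  have "((\<lambda>s. sqrt (s\<^sup>2 + e\<^sup>2)) has_real_derivative s / sqrt (s\<^sup>2 + e\<^sup>2)) (at s)"
    using pos by (auto intro!: derivative_eq_intros simp: field_simps)
  moreover have nz: "sqrt (s\<^sup>2 + e\<^sup>2) \<noteq> 0" using pos assms by auto
  ultimately have D: "((\<lambda>s. (max 0 s)\<^sup>2 / sqrt (s\<^sup>2 + e\<^sup>2)) has_real_derivative
      (2 * max 0 s * sqrt (s\<^sup>2 + e\<^sup>2) - s / sqrt (s\<^sup>2 + e\<^sup>2) * (max 0 s)\<^sup>2) / sqrt (s\<^sup>2 + e\<^sup>2) ^ Suc (Suc 0)) (at s)"
    by (rule DERIV_quotient[OF DERIV_max_0_power2])
  have eq: "(2 * m * q - s / q * m\<^sup>2) / q ^ Suc (Suc 0) = 2 * m / q - m\<^sup>2 * s / q ^ 3" if "q \<noteq> 0" for m q :: real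
    using that by (simp add: field_simps power2_eq_square power3_eq_cube)
  show ?thesis unfolding pos_reg_def[abs_def] pos_reg_deriv_def by (rule DERIV_cong[OF D eq[OF nz]])
qed

text \<open>The two terms are bounded by 2 and 1 because s^+ and |s| are at most the square root.
  Independence of \<open>e\<close> matters: one majorant must serve while \<open>e\<close> tends to
  0.\<close>

lemma abs_pos_reg_deriv_le:
  assumes "0 < e"
  shows "\<bar>pos_reg_deriv e s\<bar> \<le> 3"
proof -
  let ?q = "sqrt (s\<^sup>2 + e\<^sup>2)"
  have q: "0 < ?q" using sum_power2_pos[OF assms] by simp
  have m: "max 0 s \<le> ?q" using real_sqrt_ge_abs1[of s e] q by linarith
  have s: "\<bar>s\<bar> \<le> ?q" by (rule real_sqrt_ge_abs1)
  have 1: "\<bar>2 * max 0 s / ?q\<bar> \<le> 2" using m q by (simp add: field_simps)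
  have "\<bar>(max 0 s)\<^sup>2 * s\<bar> \<le> ?q\<^sup>2 * ?q"
    unfolding abs_mult using m s by (intro mult_mono) (auto intro!: power_mono simp del: real_sqrt_pow2)
  also have "\<dots> = ?q ^ 3" by (simp add: power3_eq_cube power2_eq_square)
  finally have 2: "\<bar>(max 0 s)\<^sup>2 * s / ?q ^ 3\<bar> \<le> 1" using q by (simp add: field_simps)
  show ?thesis unfolding pos_reg_deriv_def using 1 2 by linarith
qed

text \<open>At a positive limit the rates of \<open>e\<close> and \<open>s\<close> are irrelevant.
  At limit 0 the derivative need not tend to 1 (take \<open>s = e\<close>), which is why
  \<open>W0_dom_approx\<close> asks for a positive function.\<close>

lemma tendsto_pos_reg:
  assumes e: "e \<longlonglongrightarrow> 0" and s: "s \<longlonglongrightarrow> t" and t: "0 < t"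
  shows "(\<lambda>k::nat. pos_reg (e k) (s k)) \<longlonglongrightarrow> t" and "(\<lambda>k. pos_reg_deriv (e k) (s k)) \<longlonglongrightarrow> 1"
proof -
  have q: "(\<lambda>k. sqrt ((s k)\<^sup>2 + (e k)\<^sup>2)) \<longlonglongrightarrow> sqrt (t\<^sup>2 + 0\<^sup>2)" by (intro tendsto_intros e s)
  then have q: "(\<lambda>k. sqrt ((s k)\<^sup>2 + (e k)\<^sup>2)) \<longlonglongrightarrow> t" using t by simp
  have m: "(\<lambda>k. max 0 (s k)) \<longlonglongrightarrow> max 0 t" by (intro tendsto_intros s)
  then have m: "(\<lambda>k. max 0 (s k)) \<longlonglongrightarrow> t" using t by simp
  have "(\<lambda>k. pos_reg (e k) (s k)) \<longlonglongrightarrow> t\<^sup>2 / t"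
    unfolding pos_reg_def using t by (intro tendsto_intros q m) auto
  then show "(\<lambda>k. pos_reg (e k) (s k)) \<longlonglongrightarrow> t" using t by (simp add: power2_eq_square)
  have "(\<lambda>k. pos_reg_deriv (e k) (s k)) \<longlonglongrightarrow> 2 * t / t - t\<^sup>2 * t / t ^ 3"
    unfolding pos_reg_deriv_def using t by (intro tendsto_intros q m s) auto
  then show "(\<lambda>k. pos_reg_deriv (e k) (s k)) \<longlonglongrightarrow> 1" using t by (simp add: power2_eq_square power3_eq_cube)
qed

lemma Cc1_pos_reg:
  assumes \<phi>: "Cc1 \<Omega> \<phi>" and e: "0 < e"
  shows "Cc1 \<Omega> (\<lambda>x. pos_reg e (\<phi> x))"
    and "grad (\<lambda>x. pos_reg e (\<phi> x)) x = pos_reg_deriv e (\<phi> x) *\<^sub>R grad \<phi> x"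
proof -
  have D: "GDERIV (\<lambda>x. pos_reg e (\<phi> x)) x :> pos_reg_deriv e (\<phi> x) *\<^sub>R grad \<phi> x" for x
    by (rule GDERIV_DERIV_compose[OF Cc1_grad(1)[OF \<phi>] DERIV_pos_reg[OF e]])
  have nz: "sqrt ((\<phi> x)\<^sup>2 + e\<^sup>2) \<noteq> 0" for x using sum_power2_pos[OF e, of "\<phi> x"] e by auto
  show "Cc1 \<Omega> (\<lambda>x. pos_reg e (\<phi> x))"
  proof (rule Cc1_subsupport[OF \<phi> D])
    show "continuous_on UNIV (\<lambda>x. pos_reg_deriv e (\<phi> x) *\<^sub>R grad \<phi> x)"
      unfolding pos_reg_deriv_def
      by (intro continuous_intros Cc1_grad(2)[OF \<phi>] Cc1_grad(3)[OF \<phi>]) (use nz in auto)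
  qed (simp add: pos_reg_def)
  show "grad (\<lambda>x. pos_reg e (\<phi> x)) x = pos_reg_deriv e (\<phi> x) *\<^sub>R grad \<phi> x" by (rule grad_eq[OF D])
qed

section \<open>From L^p convergence to dominated pointwise convergence\<close>

lemma tendsto_of_norm_powr:
  fixes f :: "nat \<Rightarrow> 'a::real_normed_vector"
  assumes "(\<lambda>k. norm (f k - l) powr p) \<longlonglongrightarrow> 0" "0 < p"
  shows "f \<longlonglongrightarrow> l"
proof -
  have "(\<lambda>k. (norm (f k - l) powr p) powr (1/p)) \<longlonglongrightarrow> 0 powr (1/p)"
    using assms by (intro tendsto_powr') auto
  then have "(\<lambda>k. norm (f k - l)) \<longlonglongrightarrow> 0"
    using assms by (simp add: powr_powr)
  then show ?thesis by (simp add: tendsto_norm_zero_iff LIM_zero_iff)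
qed

lemma integrable_norm_diff_powr:
  fixes f g :: "'a \<Rightarrow> 'b::euclidean_space"
  assumes [measurable]: "f \<in> borel_measurable M" "g \<in> borel_measurable M"
    and int: "integrable M (\<lambda>x. norm (f x) powr p)" "integrable M (\<lambda>x. norm (g x) powr p)" and p: "0 < p"
  shows "integrable M (\<lambda>x. norm (f x - g x) powr p)"
proof (rule Bochner_Integration.integrable_bound)
  show "integrable M (\<lambda>x. 2 powr p * (norm (f x) powr p + norm (g x) powr p))" using int by auto
  have "norm (f x - g x) powr p \<le> 2 powr p * (norm (f x) powr p + norm (g x) powr p)" for x
    using norm_comb_powr_le[of 1 1 "-1" "f x" p "norm (f x) powr p" "g x"] p by simp
  then show "AE x in M. norm (norm (f x - g x) powr p) \<le> norm (2 powr p * (norm (f x) powr p + norm (g x) powr p))"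
    by (intro AE_I2) (simp add: abs_of_nonneg)
qed measurable

lemma W0_dom_approx:
  assumes \<Omega>: "open \<Omega>" "bounded \<Omega>" and p: "1 < p" and W: "W0 p \<Omega> u g"
    and pos: "AE x in lebesgue_on \<Omega>. 0 < u x"
  obtains \<phi> where "dom_approx p \<Omega> \<phi> u g"
proof -
  let ?M = "lebesgue_on \<Omega>"
  have um [measurable]: "u \<in> borel_measurable ?M" and gm [measurable]: "g \<in> borel_measurable ?M"
    and ui: "integrable ?M (\<lambda>x. \<bar>u x\<bar> powr p)" and gi: "integrable ?M (\<lambda>x. norm (g x) powr p)"
    using W unfolding W0_def by auto
  obtain \<phi> where Cc: "\<And>k. Cc1 \<Omega> (\<phi> k)"
    and l: "(\<lambda>k. \<integral>x. \<bar>\<phi> k x - u x\<bar> powr p \<partial>?M) \<longlonglongrightarrow> 0"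
           "(\<lambda>k. \<integral>x. norm (grad (\<phi> k) x - g x) powr p \<partial>?M) \<longlonglongrightarrow> 0"
    using W unfolding W0_def by blast
  have Cm [measurable]: "\<phi> k \<in> borel_measurable ?M" "grad (\<phi> k) \<in> borel_measurable ?M" for k
    using Cc1_measurable[OF Cc \<Omega>(1)] by auto
  \<comment> \<open>A Bochner integral of a nonintegrable function is 0, so the limits
    \<open>l\<close> carry information only after the differences are shown to have integrable p-th
    powers.\<close>
  have ci: "integrable ?M (\<lambda>x. norm (\<phi> k x) powr p)" "integrable ?M (\<lambda>x. norm (grad (\<phi> k) x) powr p)" for k
  proof -
    obtain B where B: "\<And>x. \<bar>\<phi> k x\<bar> \<le> B" "\<And>x. norm (grad (\<phi> k) x) \<le> B" using Cc1_bounded[OF Cc] by metis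
    show "integrable ?M (\<lambda>x. norm (\<phi> k x) powr p)"
      by (rule bounded_integrable_powr[OF \<Omega> Cm(1), where B=B]) (use B p in auto)
    show "integrable ?M (\<lambda>x. norm (grad (\<phi> k) x) powr p)"
      by (rule bounded_integrable_powr[OF \<Omega> Cm(2) B(2)]) (use p in auto)
  qed
  \<comment> \<open>Adding the two errors gives one selection of indices that works for values and
    gradients alike.\<close>
  define f where "f k x = \<bar>\<phi> k x - u x\<bar> powr p + norm (grad (\<phi> k) x - g x) powr p" for k x
  have fi1: "integrable ?M (\<lambda>x. \<bar>\<phi> k x - u x\<bar> powr p)" for k
    using integrable_norm_diff_powr[OF Cm(1) um ci(1)] ui p by simp
  have fi2: "integrable ?M (\<lambda>x. norm (grad (\<phi> k) x - g x) powr p)" for k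
    using integrable_norm_diff_powr[OF Cm(2) gm ci(2) gi] p by simp
  have fi: "integrable ?M (f k)" for k unfolding f_def using fi1 fi2 by (rule Bochner_Integration.integrable_add)
  have f0: "0 \<le> f k x" for k x unfolding f_def by simp
  have "(\<lambda>k. \<integral>x. f k x \<partial>?M) \<longlonglongrightarrow> 0"
    using tendsto_add[OF l] unfolding f_def Bochner_Integration.integral_add[OF fi1 fi2] by simp
  from dominated_subseq_of_L1_null[OF fi f0 this] obtain r E where
    r: "AE x in ?M. (\<lambda>n. f (r n) x) \<longlonglongrightarrow> 0" and E: "integrable ?M E" "\<And>n. AE x in ?M. f (r n) x \<le> E x" by blast
  have E': "AE x in ?M. \<forall>n. f (r n) x \<le> E x" using E(2) by (simp add: AE_all_countable)
  have conv: "(\<lambda>n. \<phi> (r n) x) \<longlonglongrightarrow> u x" "(\<lambda>n. grad (\<phi> (r n)) x) \<longlonglongrightarrow> g x"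
    if "(\<lambda>n. f (r n) x) \<longlonglongrightarrow> 0" for x
  proof -
    have "(\<lambda>n. norm (\<phi> (r n) x - u x) powr p) \<longlonglongrightarrow> 0" "(\<lambda>n. norm (grad (\<phi> (r n)) x - g x) powr p) \<longlonglongrightarrow> 0"
      by (rule tendsto_sandwich[OF _ _ tendsto_const that]; simp add: f_def)+
    then show "(\<lambda>n. \<phi> (r n) x) \<longlonglongrightarrow> u x" "(\<lambda>n. grad (\<phi> (r n)) x) \<longlonglongrightarrow> g x"
      using p by (auto intro: tendsto_of_norm_powr)
  qed
  define e where "e n = inverse (real (Suc n))" for n
  have e: "0 < e n" "e \<longlonglongrightarrow> 0" for n unfolding e_def using LIMSEQ_inverse_real_of_nat by auto
  define z where "z n x = pos_reg (e n) (\<phi> (r n) x)" for n x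
  have zg: "grad (z n) x = pos_reg_deriv (e n) (\<phi> (r n) x) *\<^sub>R grad (\<phi> (r n)) x" for n x
    unfolding z_def by (rule Cc1_pos_reg(2)[OF Cc e(1)])
  have "dom_approx p \<Omega> z u g"
    unfolding dom_approx_def
  proof (intro conjI allI exI)
    show "Cc1 \<Omega> (z n)" for n unfolding z_def by (rule Cc1_pos_reg(1)[OF Cc e(1)])
    show "0 \<le> z n x" for n x unfolding z_def pos_reg_def by simp
    show "AE x in ?M. (\<lambda>k. z k x) \<longlonglongrightarrow> u x \<and> (\<lambda>k. grad (z k) x) \<longlonglongrightarrow> g x"
      using r pos
    proof eventually_elim
      case (elim x)
      note c = conv[OF elim(1)] and t = tendsto_pos_reg[OF e(2) conv(1)[OF elim(1)] elim(2)]
      from t(1) tendsto_scaleR[OF t(2) c(2)] show ?case unfolding zg by (simp add: z_def)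
    qed
    show "integrable ?M (\<lambda>x. 3 powr p * (2 powr p * (E x + norm (g x) powr p)))"
      using E(1) gi by auto
    show "AE x in ?M. \<forall>k. norm (grad (z k) x) powr p \<le> 3 powr p * (2 powr p * (E x + norm (g x) powr p))"
      using E'
    proof eventually_elim
      case (elim x)
      show ?case
      proof
        fix k
        let ?d = "pos_reg_deriv (e k) (\<phi> (r k) x)"
        have "norm (grad (\<phi> (r k)) x - g x) powr p \<le> E x"
          using elim[rule_format, of k] unfolding f_def by (smt (verit) powr_ge_zero)
        \<comment> \<open>\<open>E\<close> majorizes only the distance of the gradients to
          \<open>g\<close>, hence the splitting into error plus \<open>g\<close>.\<close>
        moreover have "grad (z k) x = ?d *\<^sub>R (grad (\<phi> (r k)) x - g x) + ?d *\<^sub>R g x"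
          unfolding zg by (simp add: scaleR_diff_right)
        ultimately show "norm (grad (z k) x) powr p \<le> 3 powr p * (2 powr p * (E x + norm (g x) powr p))"
          using p norm_comb_powr_le[OF abs_pos_reg_deriv_le[OF e(1)] abs_pos_reg_deriv_le[OF e(1)], of "grad (\<phi> (r k)) x - g x" p "E x" "g x" "norm (g x) powr p"]
          by simp
      qed
    qed
  qed fact+
  then show thesis by (rule that)
qed

text \<open>A smooth substitute for half the minimum: \<open>soft_min e (\<phi> n x) (v x)\<close> has the compact support and
  the bound of \<open>\<phi> n\<close>, and lies below \<open>v\<close>.\<close>

definition soft_min :: "real \<Rightarrow> real \<Rightarrow> real \<Rightarrow> real" where
  "soft_min e s t = s * t / (s + t + e)"

lemma soft_min_deriv_le:
  fixes e s t :: real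
  assumes "0 < e" "0 \<le> s" "0 \<le> t"
  shows "\<bar>t * (t + e) / (s + t + e)\<^sup>2\<bar> \<le> 1"
proof -
  have "t * (t + e) \<le> (s + t + e) * (s + t + e)" using assms by (intro mult_mono) auto
  moreover have "0 \<le> t * (t + e)" "0 < (s + t + e)\<^sup>2" using assms by auto
  ultimately show ?thesis by (simp add: power2_eq_square)
qed

lemma C1_quadrant_soft_min:
  assumes e: "0 < e"
  shows "C1_quadrant (soft_min e) (\<lambda>s t. t * (t + e) / (s + t + e)\<^sup>2) (\<lambda>s t. s * (s + e) / (s + t + e)\<^sup>2)"
  unfolding C1_quadrant_def
proof (intro conjI allI impI)
  fix s t :: real assume st: "0 \<le> s" "0 \<le> t"
  then have pos: "s + t + e \<noteq> 0" using e by linarith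
  have "((\<lambda>z. fst z * snd z / (fst z + snd z + e)) has_derivative
      (\<lambda>h. t * (t + e) / (s + t + e)\<^sup>2 * fst h + s * (s + e) / (s + t + e)\<^sup>2 * snd h)) (at (s, t))"
  proof -
    have n: "((\<lambda>z. fst z * snd z) has_derivative (\<lambda>h. s * snd h + fst h * t)) (at (s, t))"
      by (auto intro!: derivative_eq_intros)
    have d: "((\<lambda>z. fst z + snd z + e) has_derivative (\<lambda>h. fst h + snd h)) (at (s, t))"
      by (auto intro!: derivative_eq_intros)
    have "((\<lambda>z. fst z * snd z / (fst z + snd z + e)) has_derivative
      (\<lambda>h. ((s * snd h + fst h * t) * (s + t + e) - s * t * (fst h + snd h)) / ((s + t + e) * (s + t + e)))) (at (s, t))"
      using has_derivative_divide'[OF n d] pos by simp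
    moreover have "((s * snd h + fst h * t) * (s + t + e) - s * t * (fst h + snd h)) / ((s + t + e) * (s + t + e))
      = t * (t + e) / (s + t + e)\<^sup>2 * fst h + s * (s + e) / (s + t + e)\<^sup>2 * snd h" for h
    proof -
      have "(s * snd h + fst h * t) * (s + t + e) - s * t * (fst h + snd h) = t * (t + e) * fst h + s * (s + e) * snd h"
        by (simp add: algebra_simps)
      then show ?thesis by (simp only: power2_eq_square add_divide_distrib times_divide_eq_left)
    qed
    ultimately show ?thesis by simp
  qed
  then show "((\<lambda>z. soft_min e (fst z) (snd z)) has_derivative
      (\<lambda>h. t * (t + e) / (s + t + e)\<^sup>2 * fst h + s * (s + e) / (s + t + e)\<^sup>2 * snd h)) (at (s, t))"
    by (simp add: soft_min_def)
next
  have nz: "fst z + snd z + e \<noteq> 0" if "z \<in> {0..} \<times> {0..}" for z :: "real \<times> real"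
    using that e by (auto simp: mem_Times_iff add_nonneg_pos less_imp_neq[symmetric])
  show "continuous_on ({0..} \<times> {0..}) (\<lambda>z. snd z * (snd z + e) / (fst z + snd z + e)\<^sup>2)"
    "continuous_on ({0..} \<times> {0..}) (\<lambda>z. fst z * (fst z + e) / (fst z + snd z + e)\<^sup>2)"
    by (intro continuous_intros; simp add: nz)+
next
  have b: "\<bar>t * (t + e) / (s + t + e)\<^sup>2\<bar> \<le> 1 \<and> \<bar>s * (s + e) / (s + t + e)\<^sup>2\<bar> \<le> 1"
    if "0 \<le> s" "0 \<le> t" for s t
    using soft_min_deriv_le[OF e that] soft_min_deriv_le[OF e that(2,1)] by (simp only: add.commute[of t s])
  show "\<exists>C. \<forall>s\<ge>0. \<forall>t\<ge>0. \<bar>t * (t + e) / (s + t + e)\<^sup>2\<bar> \<le> C \<and> \<bar>s * (s + e) / (s + t + e)\<^sup>2\<bar> \<le> C"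
    by (intro exI[of _ 1] allI impI b)
next
  show "0 \<le> soft_min e s t" if "0 \<le> s" "0 \<le> t" for s t using that e by (simp add: soft_min_def)
  show "soft_min e 0 t = 0" for t by (simp add: soft_min_def)
  show "(\<lambda>z. soft_min e (fst z) (snd z)) \<in> borel_measurable borel"
    unfolding soft_min_def borel_prod[symmetric] by measurable
  show "(\<lambda>z. snd z * (snd z + e) / (fst z + snd z + e)\<^sup>2) \<in> borel_measurable borel"
    "(\<lambda>z. fst z * (fst z + e) / (fst z + snd z + e)\<^sup>2) \<in> borel_measurable borel"
    unfolding borel_prod[symmetric] by measurable
qed

lemma soft_min_le:
  assumes "0 < e" "0 \<le> s" "0 \<le> t"
  shows "soft_min e s t \<le> s" "soft_min e s t \<le> t"
proof -
  have "0 < s + t + e" using assms by linarith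
  moreover have "s * t \<le> s * (s + t + e)" "s * t \<le> t * (s + t + e)"
    using assms by (auto simp: algebra_simps)
  ultimately show "soft_min e s t \<le> s" "soft_min e s t \<le> t"
    by (simp_all add: soft_min_def pos_divide_le_eq)
qed

text \<open>On the diagonal the partial derivatives are 1/4 each. Their sum 1/2 matches the limit
  \<open>t / 2\<close> of the values, and this common factor cancels in
  \<open>energy_le\<close>.\<close>

lemma soft_min_tendsto:
  assumes e: "e \<longlonglongrightarrow> 0" and s: "s \<longlonglongrightarrow> t" and t: "0 < t"
  shows "(\<lambda>k::nat. soft_min (e k) (s k) t) \<longlonglongrightarrow> t / 2"
    and "(\<lambda>k. t * (t + e k) / (s k + t + e k)\<^sup>2) \<longlonglongrightarrow> 1/4"
    and "(\<lambda>k. s k * (s k + e k) / (s k + t + e k)\<^sup>2) \<longlonglongrightarrow> 1/4"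
proof -
  have "(\<lambda>k. soft_min (e k) (s k) t) \<longlonglongrightarrow> t * t / (t + t + 0)"
    unfolding soft_min_def using t by (intro tendsto_intros e s) auto
  moreover have "(\<lambda>k. t * (t + e k) / (s k + t + e k)\<^sup>2) \<longlonglongrightarrow> t * (t + 0) / (t + t + 0)\<^sup>2"
    using t by (intro tendsto_intros e s) auto
  moreover have "(\<lambda>k. s k * (s k + e k) / (s k + t + e k)\<^sup>2) \<longlonglongrightarrow> t * (t + 0) / (t + t + 0)\<^sup>2"
    using t by (intro tendsto_intros e s) auto
  ultimately show "(\<lambda>k. soft_min (e k) (s k) t) \<longlonglongrightarrow> t / 2"
    "(\<lambda>k. t * (t + e k) / (s k + t + e k)\<^sup>2) \<longlonglongrightarrow> 1/4" "(\<lambda>k. s k * (s k + e k) / (s k + t + e k)\<^sup>2) \<longlonglongrightarrow> 1/4"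
    using t by (simp_all add: power2_eq_square)
qed

section \<open>Admissible test functions in the weak formulation\<close>

text \<open>The source is frozen as a function \<open>f\<close> of x alone, so admissibility is a
  linear question in \<open>f\<close>; the nonlinearity returns only in the sign argument of the
  comparison.\<close>

locale p_laplace_solution =
  fixes p :: real and \<Omega> :: "'a::euclidean_space set" and f v :: "'a \<Rightarrow> real" and g :: "'a \<Rightarrow> 'a"
  assumes open_domain: "open \<Omega>" and bounded_domain: "bounded \<Omega>" and p_gt_1: "1 < p"
    and W0: "W0 p \<Omega> v g" and pos: "AE x in lebesgue_on \<Omega>. 0 < v x"
    and source_nonneg: "AE x in lebesgue_on \<Omega>. 0 \<le> f x"
    and locally_integrable: "\<And>K. compact K \<Longrightarrow> K \<subseteq> \<Omega> \<Longrightarrow> integrable (lebesgue_on K) f"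
    and weak_equation: "\<And>\<phi>. Cc1 \<Omega> \<phi> \<Longrightarrow>
      (\<integral>x. norm (g x) powr (p - 2) * (g x \<bullet> grad \<phi> x) \<partial>lebesgue_on \<Omega>) = (\<integral>x. f x * \<phi> x \<partial>lebesgue_on \<Omega>)"
begin

abbreviation "M \<equiv> lebesgue_on \<Omega>"

lemma v_measurable: "v \<in> borel_measurable M" and g_measurable: "g \<in> borel_measurable M"
  and g_powr_integrable: "integrable M (\<lambda>x. norm (g x) powr p)"
  using W0 unfolding W0_def by simp_all

lemma integrable_indicator_compact:
  assumes K: "compact K" "K \<subseteq> \<Omega>"
  shows "integrable M (\<lambda>x. indicator K x * f x)"
proof -
  have K': "K \<in> sets lebesgue" using K by (simp add: lmeasurable_compact fmeasurableD)
  have "integrable lebesgue (\<lambda>x. indicator K x *\<^sub>R f x)"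
    using locally_integrable[OF K] K' by (simp add: integrable_restrict_space)
  moreover have "(\<lambda>x. indicator K x *\<^sub>R f x) = (\<lambda>x. indicator \<Omega> x *\<^sub>R (indicator K x * f x))"
    using K(2) by (intro ext) (auto simp: indicator_def)
  ultimately have "integrable lebesgue (\<lambda>x. indicator \<Omega> x *\<^sub>R (indicator K x * f x))"
    by (simp only:)
  then show ?thesis
    using open_domain by (simp add: integrable_restrict_space)
qed

text \<open>Measurability on all of \<Omega> is recovered from local integrability along a compact
  exhaustion.\<close>

lemma source_measurable: "f \<in> borel_measurable M"
proof -
  obtain C where C: "\<And>n::nat. compact (C n)" "\<And>n. C n \<subseteq> \<Omega>" "\<And>K. compact K \<Longrightarrow> K \<subseteq> \<Omega> \<Longrightarrow> \<exists>N. \<forall>n\<ge>N. K \<subseteq> C n"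
    using open_Union_compact_subsets[OF open_domain] by metis
  show ?thesis
  proof (rule borel_measurable_LIMSEQ_real)
    show "(\<lambda>x. indicator (C n) x * f x) \<in> borel_measurable M" for n
      using integrable_indicator_compact[OF C(1,2)] by (rule borel_measurable_integrable)
    fix x assume "x \<in> space M"
    then obtain N where "\<forall>n\<ge>N. {x} \<subseteq> C n" using C(3)[of "{x}"] by auto
    then have "\<forall>n\<ge>N. indicator (C n) x * f x = f x" by simp
    then have "\<forall>\<^sub>F n in sequentially. indicator (C n) x * f x = f x"
      unfolding eventually_sequentially by (rule exI)
    then show "(\<lambda>n. indicator (C n) x * f x) \<longlonglongrightarrow> f x" by (rule tendsto_eventually)
  qed
qed

lemma source_Cc1_integrable:
  assumes \<phi>: "Cc1 \<Omega> \<phi>"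
  shows "integrable M (\<lambda>x. f x * \<phi> x)"
proof -
  let ?K = "closure {x. \<phi> x \<noteq> 0}"
  obtain B where B: "\<And>x. \<bar>\<phi> x\<bar> \<le> B" using Cc1_bounded[OF \<phi>] by metis
  have K: "compact ?K" "?K \<subseteq> \<Omega>" using \<phi> unfolding Cc1_def by auto
  note [measurable] = source_measurable Cc1_measurable[OF \<phi> open_domain]
  show ?thesis
  proof (rule Bochner_Integration.integrable_bound)
    show "integrable M (\<lambda>x. B * (indicator ?K x * f x))"
      using integrable_indicator_compact[OF K] by (rule integrable_mult_right)
    have "norm (f x * \<phi> x) \<le> norm (B * (indicator ?K x * f x))" for x
    proof (cases "\<phi> x = 0")
      case False
      then have "x \<in> ?K" using closure_subset[of "{x. \<phi> x \<noteq> 0}"] by blast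
      moreover have "\<bar>\<phi> x\<bar> \<le> \<bar>B\<bar>" using B[of x] by linarith
      ultimately show ?thesis by (simp add: abs_mult mult.commute mult_right_mono)
    qed simp
    then show "AE x in M. norm (f x * \<phi> x) \<le> norm (B * (indicator ?K x * f x))" by simp
  qed measurable
qed

text \<open>The weak equation turns the source integrals of \<open>z k\<close> into flux integrals,
  and their convergence is the bound required by \<open>fatou_le\<close>.\<close>

lemma integral_source_le:
  assumes z: "dom_approx p \<Omega> z w h"
  shows "integrable M (\<lambda>x. f x * w x)"
    and "(\<integral>x. f x * w x \<partial>M) \<le> (\<integral>x. norm (g x) powr (p - 2) * (g x \<bullet> h x) \<partial>M)"
proof -
  note Cc = dom_approxD(1)[OF z]
  have 1: "integrable M (\<lambda>x. f x * z k x)" for k by (rule source_Cc1_integrable[OF Cc])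
  have 2: "AE x in M. 0 \<le> f x * z k x" for k
    using source_nonneg by eventually_elim (simp add: dom_approxD(2)[OF z])
  have 3: "(\<lambda>x. f x * w x) \<in> borel_measurable M"
    using source_measurable dom_approxD(3)[OF z] by (rule borel_measurable_times)
  have 4: "AE x in M. (\<lambda>k. f x * z k x) \<longlonglongrightarrow> f x * w x"
    using dom_approxD(5)[OF z] by eventually_elim (intro tendsto_intros)
  have 5: "(\<integral>x. f x * z k x \<partial>M) \<le> (\<integral>x. norm (g x) powr (p - 2) * (g x \<bullet> grad (z k) x) \<partial>M)" for k
    by (simp add: weak_equation[OF Cc])
  note 6 = dom_approx_flux(2)[OF z p_gt_1 open_domain g_measurable g_powr_integrable]
  show "integrable M (\<lambda>x. f x * w x)"
    "(\<integral>x. f x * w x \<partial>M) \<le> (\<integral>x. norm (g x) powr (p - 2) * (g x \<bullet> h x) \<partial>M)"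
    by (rule fatou_le[OF 1 2 3 4 5 6])+
qed

text \<open>This is the direction opposite to Fatou. The products \<open>f x * \<phi> k x\<close>
  have no evident common integrable majorant, so v is reached through
  \<open>soft_min (e n) (\<phi> n x) (v x)\<close> in two limits: with n fixed,
  \<open>f x * \<phi> n x\<close> dominates because \<phi> n has compact support; as n grows,
  \<open>f x * v x\<close> dominates, being integrable by \<open>integral_source_le\<close>.\<close>

lemma energy_le:
  assumes \<phi>: "dom_approx p \<Omega> \<phi> v g"
  shows "(\<integral>x. norm (g x) powr p \<partial>M) \<le> (\<integral>x. f x * v x \<partial>M)"
proof -
  define e where "e n = inverse (real (Suc n))" for n
  have e: "0 < e n" "e \<longlonglongrightarrow> 0" for n unfolding e_def using LIMSEQ_inverse_real_of_nat by auto
  define Ps Pt where "Ps n s t = t * (t + e n) / (s + t + e n)\<^sup>2" and "Pt n s t = s * (s + e n) / (s + t + e n)\<^sup>2"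
    for n and s t :: real
  have C1: "C1_quadrant (soft_min (e n)) (Ps n) (Pt n)" for n
    unfolding Ps_def Pt_def by (rule C1_quadrant_soft_min[OF e(1)])
  note Cc = dom_approxD(1)[OF \<phi>] and nn = dom_approxD(2)[OF \<phi>]
  note vm [measurable] = v_measurable and gm [measurable] = g_measurable and fm [measurable] = source_measurable
  have [measurable]: "\<phi> k \<in> borel_measurable M" "grad (\<phi> k) \<in> borel_measurable M" for k
    by (rule Cc1_measurable[OF Cc open_domain])+
  have fv: "integrable M (\<lambda>x. f x * v x)" by (rule integral_source_le(1)[OF \<phi>])
  define D where "D n x = Ps n (\<phi> n x) (v x) *\<^sub>R grad (\<phi> n) x + Pt n (\<phi> n x) (v x) *\<^sub>R g x" for n x
  \<comment> \<open>The first slot is frozen at \<open>\<phi> n\<close> and approximates itself;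
    only the second slot moves with \<open>k\<close>.\<close>
  have approx: "dom_approx p \<Omega> (\<lambda>k x. soft_min (e n) (\<phi> n x) (\<phi> k x)) (\<lambda>x. soft_min (e n) (\<phi> n x) (v x)) (D n)" for n
    unfolding D_def
    by (rule dom_approx_comp[OF C1 dom_approx_const[OF open_domain bounded_domain _ Cc nn] \<phi>])
       (use p_gt_1 in auto)
  have m: "(\<lambda>x. soft_min (e n) (\<phi> n x) (v x)) \<in> borel_measurable M" for n
    by (rule dom_approxD(3)[OF approx])
  have Dm: "D n \<in> borel_measurable M" for n by (rule dom_approxD(4)[OF approx])
  have eq: "(\<integral>x. f x * soft_min (e n) (\<phi> n x) (v x) \<partial>M) = (\<integral>x. norm (g x) powr (p - 2) * (g x \<bullet> D n x) \<partial>M)" for n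
  proof (rule LIMSEQ_unique)
    have Cck: "Cc1 \<Omega> (\<lambda>x. soft_min (e n) (\<phi> n x) (\<phi> k x))" for k by (rule dom_approxD(1)[OF approx])
    show "(\<lambda>k. \<integral>x. norm (g x) powr (p - 2) * (g x \<bullet> grad (\<lambda>x. soft_min (e n) (\<phi> n x) (\<phi> k x)) x) \<partial>M)
        \<longlonglongrightarrow> (\<integral>x. norm (g x) powr (p - 2) * (g x \<bullet> D n x) \<partial>M)"
      by (rule dom_approx_flux(2)[OF approx p_gt_1 open_domain gm g_powr_integrable])
    show "(\<lambda>k. \<integral>x. norm (g x) powr (p - 2) * (g x \<bullet> grad (\<lambda>x. soft_min (e n) (\<phi> n x) (\<phi> k x)) x) \<partial>M)
        \<longlonglongrightarrow> (\<integral>x. f x * soft_min (e n) (\<phi> n x) (v x) \<partial>M)"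
      unfolding weak_equation[OF Cck]
    proof (rule integral_dominated_convergence)
      show "integrable M (\<lambda>x. f x * \<phi> n x)" by (rule source_Cc1_integrable[OF Cc])
      show "(\<lambda>x. f x * soft_min (e n) (\<phi> n x) (v x)) \<in> borel_measurable M"
        by (rule borel_measurable_times[OF fm m])
      show "(\<lambda>x. f x * soft_min (e n) (\<phi> n x) (\<phi> k x)) \<in> borel_measurable M" for k
        by (rule borel_measurable_times[OF fm Cc1_measurable(1)[OF Cck open_domain]])
      show "AE x in M. (\<lambda>k. f x * soft_min (e n) (\<phi> n x) (\<phi> k x)) \<longlonglongrightarrow> f x * soft_min (e n) (\<phi> n x) (v x)"
        using dom_approxD(5)[OF approx] by eventually_elim (intro tendsto_intros)
      show "AE x in M. norm (f x * soft_min (e n) (\<phi> n x) (\<phi> k x)) \<le> f x * \<phi> n x" for k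
        using source_nonneg
      proof eventually_elim
        case (elim x)
        have "0 \<le> soft_min (e n) (\<phi> n x) (\<phi> k x)" by (rule dom_approxD(2)[OF approx])
        with elim soft_min_le(1)[OF e(1) nn nn] show ?case by (simp add: abs_mult mult_left_mono)
      qed
    qed
  qed
  obtain E where E: "integrable M E" "AE x in M. \<forall>k. norm (grad (\<phi> k) x) powr p \<le> E x"
    using dom_approx_bound[OF \<phi>] .
  have le1: "\<bar>Ps n s t\<bar> \<le> 1" "\<bar>Pt n s t\<bar> \<le> 1" if "0 \<le> s" "0 \<le> t" for n s t
    unfolding Ps_def Pt_def using soft_min_deriv_le[OF e(1) that] soft_min_deriv_le[OF e(1) that(2,1)]
    by (simp_all only: add.commute[of t s])
  \<comment> \<open>Second limit: \<open>soft_min\<close> lies below its second argument, so the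
    majorant no longer depends on \<open>\<phi> n\<close>.\<close>
  have lim1: "(\<lambda>n. \<integral>x. f x * soft_min (e n) (\<phi> n x) (v x) \<partial>M) \<longlonglongrightarrow> (\<integral>x. f x * (v x / 2) \<partial>M)"
  proof (rule integral_dominated_convergence)
    show "integrable M (\<lambda>x. f x * v x)" by (rule fv)
    show "(\<lambda>x. f x * soft_min (e n) (\<phi> n x) (v x)) \<in> borel_measurable M" for n
      by (rule borel_measurable_times[OF fm m])
    show "AE x in M. (\<lambda>n. f x * soft_min (e n) (\<phi> n x) (v x)) \<longlonglongrightarrow> f x * (v x / 2)"
      using dom_approxD(5)[OF \<phi>] pos
      by eventually_elim (intro tendsto_mult tendsto_const soft_min_tendsto(1)[OF e(2)])
    show "AE x in M. norm (f x * soft_min (e n) (\<phi> n x) (v x)) \<le> f x * v x" for n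
      using source_nonneg pos
    proof eventually_elim
      case (elim x)
      have "0 \<le> soft_min (e n) (\<phi> n x) (v x)" using C1_quadrantD(4)[OF C1 nn] elim by simp
      with elim soft_min_le(2)[OF e(1) nn, of "v x"] show ?case by (simp add: abs_mult mult_left_mono)
    qed
  qed measurable
  have lim2: "(\<lambda>n. \<integral>x. norm (g x) powr (p - 2) * (g x \<bullet> D n x) \<partial>M) \<longlonglongrightarrow> (\<integral>x. norm (g x) powr p / 2 \<partial>M)"
  proof (rule integral_dominated_convergence)
    show "integrable M (\<lambda>x. norm (g x) powr p + 1 powr p * (2 powr p * (E x + norm (g x) powr p)))"
      using E g_powr_integrable by auto
    show "(\<lambda>x. norm (g x) powr (p - 2) * (g x \<bullet> D n x)) \<in> borel_measurable M" for n
      using Dm[of n] by measurable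
    show "AE x in M. (\<lambda>n. norm (g x) powr (p - 2) * (g x \<bullet> D n x)) \<longlonglongrightarrow> norm (g x) powr p / 2"
      using dom_approxD(5,6)[OF \<phi>] pos
    proof eventually_elim
      case (elim x)
      have "(\<lambda>n. D n x) \<longlonglongrightarrow> (1/4) *\<^sub>R g x + (1/4) *\<^sub>R g x"
        unfolding D_def Ps_def Pt_def
        by (intro tendsto_add tendsto_scaleR elim(2) tendsto_const soft_min_tendsto(2,3)[OF e(2) elim(1,3)])
      then have "(\<lambda>n. norm (g x) powr (p - 2) * (g x \<bullet> D n x)) \<longlonglongrightarrow>
          norm (g x) powr (p - 2) * (g x \<bullet> ((1/4) *\<^sub>R g x + (1/4) *\<^sub>R g x))"
        by (intro tendsto_intros)
      then show ?case using norm_flux(1)[OF p_gt_1, of "g x"] by (simp add: inner_add_right algebra_simps)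
    qed
    show "AE x in M. norm (norm (g x) powr (p - 2) * (g x \<bullet> D n x))
        \<le> norm (g x) powr p + 1 powr p * (2 powr p * (E x + norm (g x) powr p))" for n
      using E(2) pos
    proof eventually_elim
      case (elim x)
      have "norm (D n x) powr p \<le> 1 powr p * (2 powr p * (E x + norm (g x) powr p))"
        unfolding D_def using elim nn le1 p_gt_1 by (intro norm_comb_powr_le) auto
      moreover have "norm (norm (g x) powr (p - 2) * (g x \<bullet> D n x)) \<le> norm (g x) powr (p - 1) * norm (D n x)"
        using norm_flux(2)[OF p_gt_1] by simp
      moreover have "norm (g x) powr (p - 1) * norm (D n x) \<le> norm (g x) powr p + norm (D n x) powr p"
        using p_gt_1 by (intro powr_mult_le_sum) auto
      ultimately show ?case by linarith
    qed
  qed measurable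
  \<comment> \<open>By \<open>eq\<close> both limits belong to the same sequence, and the factor 1/2
    drops out.\<close>
  from LIMSEQ_unique[OF lim1 lim2[folded eq]]
  show ?thesis by simp
qed

text \<open>Fatou's lemma for the nonnegative products of \<open>f\<close> with
  \<open>\<phi> k - z k\<close> bounds the difference of the source integrals by the difference of
  the flux integrals; \<open>energy_le\<close> then removes the terms of v. The order is required of
  the approximants, since they are what Fatou is applied to.\<close>

lemma integral_source_ge:
  assumes \<phi>: "dom_approx p \<Omega> \<phi> v g" and z: "dom_approx p \<Omega> z w h" and le: "\<And>k x. z k x \<le> \<phi> k x"
  shows "(\<integral>x. norm (g x) powr (p - 2) * (g x \<bullet> h x) \<partial>M) \<le> (\<integral>x. f x * w x \<partial>M)"
proof -
  note C\<phi> = dom_approxD(1)[OF \<phi>] and Cz = dom_approxD(1)[OF z]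
  note i\<phi> = integral_source_le(1)[OF \<phi>] and iz = integral_source_le(1)[OF z]
  have int: "integrable M (\<lambda>x. f x * \<phi> k x - f x * z k x)" for k
    by (intro Bochner_Integration.integrable_diff source_Cc1_integrable C\<phi> Cz)
  have nonneg: "AE x in M. 0 \<le> f x * \<phi> k x - f x * z k x" for k
    using source_nonneg by eventually_elim (simp add: mult_left_mono le)
  have meas: "(\<lambda>x. f x * v x - f x * w x) \<in> borel_measurable M"
    using i\<phi> iz by auto
  have lim: "AE x in M. (\<lambda>k. f x * \<phi> k x - f x * z k x) \<longlonglongrightarrow> f x * v x - f x * w x"
    using dom_approxD(5)[OF \<phi>] dom_approxD(5)[OF z] by eventually_elim (intro tendsto_intros)
  have bound: "(\<integral>x. f x * \<phi> k x - f x * z k x \<partial>M) \<le>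
      (\<integral>x. norm (g x) powr (p - 2) * (g x \<bullet> grad (\<phi> k) x) \<partial>M) -
      (\<integral>x. norm (g x) powr (p - 2) * (g x \<bullet> grad (z k) x) \<partial>M)" for k
    by (simp add: weak_equation C\<phi> Cz Bochner_Integration.integral_diff source_Cc1_integrable)
  have "(\<integral>x. f x * v x - f x * w x \<partial>M) \<le>
      (\<integral>x. norm (g x) powr (p - 2) * (g x \<bullet> g x) \<partial>M) - (\<integral>x. norm (g x) powr (p - 2) * (g x \<bullet> h x) \<partial>M)"
    by (rule fatou_le(2)[OF int nonneg meas lim bound])
      (intro tendsto_diff dom_approx_flux(2)[OF \<phi> p_gt_1 open_domain g_measurable g_powr_integrable]
        dom_approx_flux(2)[OF z p_gt_1 open_domain g_measurable g_powr_integrable])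
  with energy_le[OF \<phi>] show ?thesis
    by (simp add: Bochner_Integration.integral_diff i\<phi> iz norm_flux(1)[OF p_gt_1])
qed

end

section \<open>The Diaz-Saa test functions\<close>

text \<open>In the notation of the header, \<open>damp\<close> is \<open>V/a\<close>, \<open>ratio\<close> is \<open>b/V\<close>, \<open>excess\<close> is \<open>H\<close>, and \<open>excess'\<close> is
  \<open>R\<cdot>dH/dR\<close> with \<open>R = V/b\<close>.\<close>

definition damp :: "real \<Rightarrow> real \<Rightarrow> real" where
  "damp e s = 1 / (1 + e * (s + e))"

definition trunc :: "real \<Rightarrow> real \<Rightarrow> real" where
  "trunc e s = damp e s * (s + e)"

definition ratio :: "real \<Rightarrow> real \<Rightarrow> real \<Rightarrow> real" where
  "ratio e s t = (t + e) * (e + 1 / (s + e))"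

definition excess :: "real \<Rightarrow> real \<Rightarrow> real \<Rightarrow> real" where
  "excess e s t = (max 0 (1 - ratio e s t))\<^sup>2"

definition excess' :: "real \<Rightarrow> real \<Rightarrow> real \<Rightarrow> real" where
  "excess' e s t = 2 * max 0 (1 - ratio e s t) * ratio e s t"

lemma damp_bounds:
  assumes "0 < e" "0 \<le> s"
  shows "0 < damp e s" "damp e s \<le> 1" "0 < trunc e s" "trunc e s \<le> s + e" "trunc e s \<le> 1 / e"
    "1 + e * (s + e) \<noteq> 0" "s + e \<noteq> 0"
proof -
  have a: "0 < s + e" using assms by linarith
  have c: "0 < e * (s + e)" using assms a by simp
  show d: "0 < damp e s" "damp e s \<le> 1" "1 + e * (s + e) \<noteq> 0" "s + e \<noteq> 0"
    using a c by (auto simp: damp_def divide_simps)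
  show "0 < trunc e s" using d a by (simp add: trunc_def)
  show "trunc e s \<le> s + e" using mult_right_mono[OF d(2), of "s + e"] a by (simp add: trunc_def)
  have "damp e s * (1 + e * (s + e)) = 1" using d(3) by (simp add: damp_def)
  then have "trunc e s * e = 1 - damp e s" by (simp add: trunc_def algebra_simps)
  with d(1) have "trunc e s * e \<le> 1" by linarith
  then show "trunc e s \<le> 1 / e" using assms by (simp add: pos_le_divide_eq)
qed

text \<open>The last bound puts \<open>test1\<close> below its first argument: since t + e \<ge> e,
  the ratio is at least e/(s+e), so the base of the square is at most s/(s+e), and squaring a number
  in [0,1] does not increase it.\<close>

lemma excess_bounds:
  assumes "0 < e" "0 \<le> s" "0 \<le> t"
  shows "0 < ratio e s t" "0 \<le> excess e s t" "excess e s t \<le> 1" "0 \<le> excess' e s t" "excess' e s t \<le> 1"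
    "(s + e) * excess e s t \<le> s"
proof -
  have a: "0 < s + e" "0 < t + e" using assms by linarith+
  have "e / (s + e) \<le> (t + e) * (1 / (s + e))"
    using assms a by (simp add: divide_right_mono)
  also have "\<dots> \<le> ratio e s t" unfolding ratio_def using assms a by (intro mult_left_mono) auto
  finally have r: "e / (s + e) \<le> ratio e s t" .
  have "0 < e / (s + e)" using assms a by simp
  with r show r0: "0 < ratio e s t" by linarith
  define m where "m = max 0 (1 - ratio e s t)"
  have m: "0 \<le> m" "m \<le> 1" using r0 by (auto simp: m_def)
  show "0 \<le> excess e s t" unfolding excess_def by simp
  show "excess e s t \<le> 1" unfolding excess_def m_def[symmetric] using m by (simp add: power_le_one)
  show "0 \<le> excess' e s t" unfolding excess'_def using r0 by simp
  show "excess' e s t \<le> 1"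
  proof (cases "ratio e s t \<le> 1")
    case True
    \<comment> \<open>Expanding 1 = ((1 - r) + r)^2 turns this into 2 (1 - r) r \<le> 1.\<close>
    have "0 \<le> (1 - ratio e s t)\<^sup>2 + (ratio e s t)\<^sup>2" by simp
    then show ?thesis using True unfolding excess'_def by (simp add: max_def power2_eq_square algebra_simps)
  next
    case False
    then show ?thesis unfolding excess'_def by simp
  qed
  have "excess e s t \<le> m" unfolding excess_def m_def[symmetric] power2_eq_square
    using m by (intro mult_left_le) auto
  moreover have "e / (s + e) \<le> 1" using assms a by simp
  then have "m \<le> 1 - e / (s + e)" using r by (simp add: m_def)
  ultimately have "(s + e) * excess e s t \<le> (s + e) * (1 - e / (s + e))"
    using a by (intro mult_left_mono) auto
  also have "\<dots> = s" using a by (simp add: right_diff_distrib)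
  finally show "(s + e) * excess e s t \<le> s" .
qed

text \<open>Here the shift of the second argument is decisive: t + e \<ge> e makes the ratio at
  least e (1/e) = 1 when s = 0.\<close>

lemma excess_zero: "0 < e \<Longrightarrow> 0 \<le> t \<Longrightarrow> excess e 0 t = 0"
proof -
  assume e: "0 < e" "0 \<le> t"
  have "e * (1 / e) \<le> (t + e) * (e + 1 / e)" using e by (intro mult_mono) auto
  then show ?thesis using e by (simp add: excess_def ratio_def)
qed

text \<open>With a = s + e and \<sigma> = V/a one has V' = \<sigma>^2, hence V'/V = \<sigma>/a: the
  truncation merely scales the logarithmic derivative of a by \<sigma>.\<close>

lemma DERIV_trunc_powr:
  assumes "0 < e" "0 \<le> s"
  shows "((\<lambda>s. trunc e s powr p) has_real_derivative p * damp e s / (s + e) * trunc e s powr p) (at s)"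
proof -
  note b = damp_bounds[OF assms]
  have d: "(trunc e has_real_derivative (damp e s)\<^sup>2) (at s)"
    unfolding trunc_def[abs_def] damp_def using b(6)
    by (auto intro!: derivative_eq_intros simp: field_simps power2_eq_square)
  show ?thesis
    by (rule DERIV_cong[OF DERIV_chain2[OF has_real_derivative_powr[OF b(3)] d]])
      (use b(1,3,7) in \<open>simp add: powr_diff trunc_def power2_eq_square\<close>)
qed

lemma DERIV_shift_powr:
  fixes s e r :: real
  assumes "0 < s + e"
  shows "((\<lambda>s. (s + e) powr r) has_real_derivative r / (s + e) * (s + e) powr r) (at s)"
proof -
  have d: "((\<lambda>s. s + e) has_real_derivative 1) (at s)" by (auto intro!: derivative_eq_intros)
  show ?thesis using DERIV_chain2[OF has_real_derivative_powr[OF assms] d] assms by (simp add: powr_diff)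
qed

text \<open>H is a function of log V - log b, so the differential is \<open>excess'\<close> times
  the difference of the logarithmic differentials, \<sigma>/a ds - 1/b dt.\<close>

lemma has_derivative_excess:
  assumes "0 < e" "0 \<le> s" "0 \<le> t"
  shows "((\<lambda>z. excess e (fst z) (snd z)) has_derivative
     (\<lambda>h. excess' e s t * damp e s / (s + e) * fst h - excess' e s t / (t + e) * snd h)) (at (s, t))"
proof -
  note b = damp_bounds[OF assms(1,2)]
  have t: "t + e \<noteq> 0" using assms by linarith
  have "((\<lambda>s. e + 1 / (s + e)) has_real_derivative - (1 / (s + e)\<^sup>2)) (at s)"
    using b(7) by (auto intro!: derivative_eq_intros simp: power2_eq_square)
  then have "((\<lambda>s. e + 1 / (s + e)) has_real_derivative - (1 / (s + e)\<^sup>2)) (at (fst (s, t)))" by simp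
  then have 1: "((\<lambda>z. e + 1 / (fst z + e)) has_derivative (\<lambda>h. fst h * - (1 / (s + e)\<^sup>2))) (at (s, t))"
    by (rule DERIV_compose_FDERIV[where f="\<lambda>s. e + 1 / (s + e)" and g=fst])
      (auto intro!: derivative_intros)
  have 2: "((\<lambda>z. snd z + e) has_derivative snd) (at (s, t))"
    by (auto intro!: derivative_eq_intros)
  have r: "((\<lambda>z. 1 - ratio e (fst z) (snd z)) has_derivative
      (\<lambda>h. - ((t + e) * (fst h * - (1 / (s + e)\<^sup>2)) + snd h * (e + 1 / (s + e))))) (at (s, t))"
    unfolding ratio_def using has_derivative_diff[OF has_derivative_const has_derivative_mult[OF 2 1], of 1] by simp
  have eq: "- ((t + e) * (x * - (1 / (s + e)\<^sup>2)) + y * (e + 1 / (s + e)))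
      = ratio e s t * (damp e s / (s + e) * x - 1 / (t + e) * y)" for x y
  proof -
    have "(e + 1 / (s + e)) * (damp e s / (s + e)) = 1 / (s + e)\<^sup>2"
      using b(6,7) by (simp add: damp_def divide_simps power2_eq_square)
    then have "ratio e s t * (damp e s / (s + e)) = (t + e) * (1 / (s + e)\<^sup>2)"
      by (simp only: ratio_def mult.assoc)
    moreover have "ratio e s t * (1 / (t + e)) = e + 1 / (s + e)"
      using t by (simp add: ratio_def)
    ultimately have "ratio e s t * (damp e s / (s + e) * x - 1 / (t + e) * y) =
        (t + e) * (1 / (s + e)\<^sup>2) * x - (e + 1 / (s + e)) * y"
      by (metis right_diff_distrib mult.assoc)
    then show ?thesis by (simp add: algebra_simps)
  qed
  have "((\<lambda>z. excess e (fst z) (snd z)) has_derivative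
      (\<lambda>h. ratio e s t * (damp e s / (s + e) * fst h - 1 / (t + e) * snd h) * (2 * max 0 (1 - ratio e s t)))) (at (s, t))"
    unfolding excess_def
    by (rule DERIV_compose_FDERIV[where f="\<lambda>x. (max 0 x)\<^sup>2", OF _ r[unfolded eq]])
      (simp only: prod.sel DERIV_max_0_power2)
  then show ?thesis
    by (rule has_derivative_eq_rhs) (simp add: excess'_def fun_eq_iff algebra_simps)
qed

definition test1 :: "real \<Rightarrow> real \<Rightarrow> real \<Rightarrow> real \<Rightarrow> real" where
  "test1 p e s t = trunc e s powr p * (s + e) powr (1 - p) * excess e s t"

definition test2 :: "real \<Rightarrow> real \<Rightarrow> real \<Rightarrow> real \<Rightarrow> real" where
  "test2 p e s t = trunc e s powr p * (t + e) powr (1 - p) * excess e s t"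

text \<open>In the last factor p \<sigma> H comes from V^p, \<sigma> times \<open>excess'\<close>
  from H, and -(p - 1) H from a^(1-p). In \<open>test2_s\<close> the last part is absent and
  reappears in \<open>test2_t\<close>, where b^(1-p) is differentiated.\<close>

definition test1_s :: "real \<Rightarrow> real \<Rightarrow> real \<Rightarrow> real \<Rightarrow> real" where
  "test1_s p e s t = trunc e s powr p * (s + e) powr (1 - p) / (s + e)
     * (damp e s * (p * excess e s t + excess' e s t) - (p - 1) * excess e s t)"

definition test1_t :: "real \<Rightarrow> real \<Rightarrow> real \<Rightarrow> real \<Rightarrow> real" where
  "test1_t p e s t = - (trunc e s powr p * (s + e) powr (1 - p) / (t + e) * excess' e s t)"

definition test2_s :: "real \<Rightarrow> real \<Rightarrow> real \<Rightarrow> real \<Rightarrow> real" where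
  "test2_s p e s t = trunc e s powr p * (t + e) powr (1 - p) / (s + e)
     * (damp e s * (p * excess e s t + excess' e s t))"

definition test2_t :: "real \<Rightarrow> real \<Rightarrow> real \<Rightarrow> real \<Rightarrow> real" where
  "test2_t p e s t = - (trunc e s powr p * (t + e) powr (1 - p) / (t + e)
     * ((p - 1) * excess e s t + excess' e s t))"

lemma test_bounds:
  assumes e: "0 < e" and s: "0 \<le> s" and t: "0 \<le> t" and p: "1 < p"
  shows "0 \<le> test1 p e s t" "0 \<le> test2 p e s t" "test1 p e s t \<le> s"
proof -
  note b = damp_bounds[OF e s] and h = excess_bounds[OF e s t]
  show "0 \<le> test1 p e s t" "0 \<le> test2 p e s t" using h(2) by (auto simp: test1_def test2_def)
  have a: "0 < s + e" using e s by linarith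
  have "trunc e s powr p * (s + e) powr (1 - p) \<le> (s + e) powr p * (s + e) powr (1 - p)"
    using b p by (intro mult_right_mono powr_mono2) auto
  also have "\<dots> = s + e" using a by (simp flip: powr_add)
  finally have "test1 p e s t \<le> (s + e) * excess e s t"
    unfolding test1_def using h(2) by (rule mult_right_mono)
  with h(6) show "test1 p e s t \<le> s" by linarith
qed

lemma has_derivative_test:
  assumes e: "0 < e" and s: "0 \<le> s" and t: "0 \<le> t"
  shows "((\<lambda>z. test1 p e (fst z) (snd z)) has_derivative (\<lambda>h. test1_s p e s t * fst h + test1_t p e s t * snd h)) (at (s, t))"
    and "((\<lambda>z. test2 p e (fst z) (snd z)) has_derivative (\<lambda>h. test2_s p e s t * fst h + test2_t p e s t * snd h)) (at (s, t))"
proof -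
  have a: "0 < s + e" "0 < t + e" using e s t by linarith+
  have f: "(fst has_derivative fst) (at (s, t))" and n: "(snd has_derivative snd) (at (s, t))"
    by (auto intro!: derivative_intros)
  have T: "((\<lambda>z. trunc e (fst z) powr p) has_derivative (\<lambda>h. fst h * (p * damp e s / (s + e) * trunc e s powr p))) (at (s, t))"
    by (rule DERIV_compose_FDERIV[where f="\<lambda>s. trunc e s powr p" and g=fst, OF _ f]) (simp only: prod.sel DERIV_trunc_powr[OF e s])
  have A: "((\<lambda>z. (fst z + e) powr (1 - p)) has_derivative (\<lambda>h. fst h * ((1 - p) / (s + e) * (s + e) powr (1 - p)))) (at (s, t))"
    by (rule DERIV_compose_FDERIV[where f="\<lambda>s. (s + e) powr (1 - p)" and g=fst, OF _ f]) (simp only: prod.sel DERIV_shift_powr[OF a(1)])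
  have B: "((\<lambda>z. (snd z + e) powr (1 - p)) has_derivative (\<lambda>h. snd h * ((1 - p) / (t + e) * (t + e) powr (1 - p)))) (at (s, t))"
    by (rule DERIV_compose_FDERIV[where f="\<lambda>s. (s + e) powr (1 - p)" and g=snd, OF _ n]) (simp only: prod.sel DERIV_shift_powr[OF a(2)])
  note H = has_derivative_excess[OF e s t]
  show "((\<lambda>z. test1 p e (fst z) (snd z)) has_derivative (\<lambda>h. test1_s p e s t * fst h + test1_t p e s t * snd h)) (at (s, t))"
    unfolding test1_def
    by (rule has_derivative_eq_rhs[OF has_derivative_mult[OF has_derivative_mult[OF T A] H]])
      (simp add: fun_eq_iff test1_s_def test1_t_def divide_inverse algebra_simps)
  show "((\<lambda>z. test2 p e (fst z) (snd z)) has_derivative (\<lambda>h. test2_s p e s t * fst h + test2_t p e s t * snd h)) (at (s, t))"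
    unfolding test2_def
    by (rule has_derivative_eq_rhs[OF has_derivative_mult[OF has_derivative_mult[OF T B] H]])
      (simp add: fun_eq_iff test2_s_def test2_t_def divide_inverse algebra_simps)
qed

lemma test_deriv_bound:
  fixes e a c G K p :: real
  assumes "0 < e" "e \<le> a" "0 \<le> G" "G \<le> K" "\<bar>c\<bar> \<le> 2 * p"
  shows "\<bar>G / a * c\<bar> \<le> K / e * (2 * p)"
proof -
  have "\<bar>G / a\<bar> \<le> K / e" using assms by (simp add: frac_le)
  then show ?thesis unfolding abs_mult using assms by (intro mult_mono) auto
qed

text \<open>\<open>K\<close> combines V \<le> 1/e with a, b \<ge> e, the exponent 1 - p being
  negative; 2p bounds the coefficients because p + 1 \<le> 2p. The blow-up as e tends to 0 is
  harmless: e is fixed while the approximants converge.\<close>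

lemma test_derivs_le:
  assumes e: "0 < e" and s: "0 \<le> s" and t: "0 \<le> t" and p: "1 < p"
  defines "K \<equiv> (1 / e) powr p * e powr (1 - p)"
  shows "\<bar>test1_s p e s t\<bar> \<le> K / e * (2 * p)" "\<bar>test1_t p e s t\<bar> \<le> K / e * (2 * p)"
    "\<bar>test2_s p e s t\<bar> \<le> K / e * (2 * p)" "\<bar>test2_t p e s t\<bar> \<le> K / e * (2 * p)"
proof -
  note b = damp_bounds[OF e s] and h = excess_bounds[OF e s t]
  have a: "e \<le> s + e" "e \<le> t + e" using s t by auto
  have V: "trunc e s powr p \<le> (1 / e) powr p" using b p by (intro powr_mono2) auto
  have G: "trunc e s powr p * r powr (1 - p) \<le> K" if "e \<le> r" for r
    unfolding K_def using that e p by (intro mult_mono[OF V powr_mono2']) auto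
  let ?c = "damp e s * (p * excess e s t + excess' e s t)"
  have ph: "0 \<le> p * excess e s t" "p * excess e s t \<le> p" using h p by (auto intro: mult_left_le)
  have ph': "0 \<le> (p - 1) * excess e s t" "(p - 1) * excess e s t \<le> p - 1" using h p by (auto intro: mult_left_le)
  have c: "0 \<le> ?c" "?c \<le> p * excess e s t + excess' e s t"
    using b ph h by (auto intro!: mult_left_le_one_le)
  have c1: "\<bar>?c - (p - 1) * excess e s t\<bar> \<le> 2 * p" using c ph ph' h p by linarith
  have c2: "\<bar>excess' e s t\<bar> \<le> 2 * p" using h p by linarith
  have c3: "\<bar>?c\<bar> \<le> 2 * p" using c ph h p by linarith
  have c4: "\<bar>(p - 1) * excess e s t + excess' e s t\<bar> \<le> 2 * p" using ph' h p by linarith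
  show "\<bar>test1_s p e s t\<bar> \<le> K / e * (2 * p)" unfolding test1_s_def
    by (rule test_deriv_bound[OF e a(1) _ G[OF a(1)] c1]) simp
  show "\<bar>test1_t p e s t\<bar> \<le> K / e * (2 * p)" unfolding test1_t_def abs_minus_cancel
    by (rule test_deriv_bound[OF e a(2) _ G[OF a(1)] c2]) simp
  show "\<bar>test2_s p e s t\<bar> \<le> K / e * (2 * p)" unfolding test2_s_def
    by (rule test_deriv_bound[OF e a(1) _ G[OF a(2)] c3]) simp
  show "\<bar>test2_t p e s t\<bar> \<le> K / e * (2 * p)" unfolding test2_t_def abs_minus_cancel
    by (rule test_deriv_bound[OF e a(2) _ G[OF a(2)] c4]) simp
qed

lemma continuous_on_test_parts:
  assumes e: "0 < e"
  defines "Q \<equiv> {0..} \<times> {0..} :: (real \<times> real) set"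
  shows "continuous_on Q (\<lambda>z. trunc e (fst z) powr p)" "continuous_on Q (\<lambda>z. damp e (fst z))"
    "continuous_on Q (\<lambda>z. (fst z + e) powr r)" "continuous_on Q (\<lambda>z. (snd z + e) powr r)"
    "continuous_on Q (\<lambda>z. excess e (fst z) (snd z))" "continuous_on Q (\<lambda>z. excess' e (fst z) (snd z))"
proof -
  have z: "0 \<le> fst z" "0 \<le> snd z" if "z \<in> Q" for z using that by (auto simp: Q_def mem_Times_iff)
  have nz: "1 + e * (fst z + e) \<noteq> 0" "fst z + e \<noteq> 0" "snd z + e \<noteq> 0" "trunc e (fst z) \<noteq> 0" if "z \<in> Q" for z
    using damp_bounds[OF e z(1)[OF that]] z(2)[OF that] e by auto
  show d: "continuous_on Q (\<lambda>z. damp e (fst z))"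
    unfolding damp_def by (intro continuous_intros ballI nz)
  have "continuous_on Q (\<lambda>z. trunc e (fst z))"
    unfolding trunc_def by (intro continuous_intros d)
  then show "continuous_on Q (\<lambda>z. trunc e (fst z) powr p)"
    by (intro continuous_on_powr continuous_on_const ballI nz)
  show "continuous_on Q (\<lambda>z. (fst z + e) powr r)" "continuous_on Q (\<lambda>z. (snd z + e) powr r)"
    by (intro continuous_on_powr continuous_intros ballI nz; assumption)+
  have "continuous_on Q (\<lambda>z. ratio e (fst z) (snd z))"
    unfolding ratio_def by (intro continuous_intros ballI nz)
  then show "continuous_on Q (\<lambda>z. excess e (fst z) (snd z))" "continuous_on Q (\<lambda>z. excess' e (fst z) (snd z))"
    unfolding excess_def excess'_def by (intro continuous_intros; assumption)+
qed

lemma measurable_test_parts [measurable]: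
  "trunc e \<in> borel_measurable borel" "damp e \<in> borel_measurable borel"
  "(\<lambda>z. excess e (fst z) (snd z)) \<in> borel_measurable (borel \<Otimes>\<^sub>M borel)"
  "(\<lambda>z. excess' e (fst z) (snd z)) \<in> borel_measurable (borel \<Otimes>\<^sub>M borel)"
  unfolding trunc_def[abs_def] damp_def[abs_def] excess_def excess'_def ratio_def by measurable

lemma C1_quadrant_test:
  assumes e: "0 < e" and p: "1 < p"
  shows "C1_quadrant (test1 p e) (test1_s p e) (test1_t p e)"
    and "C1_quadrant (test2 p e) (test2_s p e) (test2_t p e)"
proof -
  have nz: "fst z + e \<noteq> 0" "snd z + e \<noteq> 0" if "z \<in> {0..} \<times> {0..}" for z :: "real \<times> real"
    using that e by (auto simp: mem_Times_iff)
  note c = continuous_on_test_parts[OF e]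
  let ?C = "(1 / e) powr p * e powr (1 - p) / e * (2 * p)"
  note b = test_derivs_le[OF e _ _ p]
  show "C1_quadrant (test1 p e) (test1_s p e) (test1_t p e)"
    unfolding C1_quadrant_def
  proof (intro conjI allI impI)
    show "continuous_on ({0..} \<times> {0..}) (\<lambda>z. test1_s p e (fst z) (snd z))"
      "continuous_on ({0..} \<times> {0..}) (\<lambda>z. test1_t p e (fst z) (snd z))"
      unfolding test1_s_def test1_t_def by (intro continuous_intros c ballI nz; assumption)+
    show "\<exists>C. \<forall>s\<ge>0. \<forall>t\<ge>0. \<bar>test1_s p e s t\<bar> \<le> C \<and> \<bar>test1_t p e s t\<bar> \<le> C"
      by (intro exI[of _ ?C] allI impI conjI b)
    show "test1 p e 0 t = 0" if "0 \<le> t" for t using excess_zero[OF e that] by (simp add: test1_def)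
    show "(\<lambda>z. test1 p e (fst z) (snd z)) \<in> borel_measurable borel"
      "(\<lambda>z. test1_s p e (fst z) (snd z)) \<in> borel_measurable borel"
      "(\<lambda>z. test1_t p e (fst z) (snd z)) \<in> borel_measurable borel"
      unfolding test1_def test1_s_def test1_t_def borel_prod[symmetric] by measurable
  qed (rule has_derivative_test(1)[OF e] test_bounds(1)[OF e _ _ p]; assumption)+
  show "C1_quadrant (test2 p e) (test2_s p e) (test2_t p e)"
    unfolding C1_quadrant_def
  proof (intro conjI allI impI)
    show "continuous_on ({0..} \<times> {0..}) (\<lambda>z. test2_s p e (fst z) (snd z))"
      "continuous_on ({0..} \<times> {0..}) (\<lambda>z. test2_t p e (fst z) (snd z))"
      unfolding test2_s_def test2_t_def by (intro continuous_intros c ballI nz; assumption)+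
    show "\<exists>C. \<forall>s\<ge>0. \<forall>t\<ge>0. \<bar>test2_s p e s t\<bar> \<le> C \<and> \<bar>test2_t p e s t\<bar> \<le> C"
      by (intro exI[of _ ?C] allI impI conjI b)
    show "test2 p e 0 t = 0" if "0 \<le> t" for t using excess_zero[OF e that] by (simp add: test2_def)
    show "(\<lambda>z. test2 p e (fst z) (snd z)) \<in> borel_measurable borel"
      "(\<lambda>z. test2_s p e (fst z) (snd z)) \<in> borel_measurable borel"
      "(\<lambda>z. test2_t p e (fst z) (snd z)) \<in> borel_measurable borel"
      unfolding test2_def test2_s_def test2_t_def borel_prod[symmetric] by measurable
  qed (rule has_derivative_test(2)[OF e] test_bounds(2)[OF e _ _ p]; assumption)+
qed

text \<open>Cauchy-Schwarz reduces the vectors to their norms, and scaling the norms by a and b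
  leaves V^p times the scalar inequality \<open>picone_pointwise\<close>.\<close>

lemma picone_test:
  fixes g h :: "'a::real_inner"
  assumes e: "0 < e" and s: "0 \<le> s" and t: "0 \<le> t" and p: "1 < p"
  shows "norm g powr (p - 2) * (g \<bullet> (test1_s p e s t *\<^sub>R g + test1_t p e s t *\<^sub>R h))
      - norm h powr (p - 2) * (h \<bullet> (test2_s p e s t *\<^sub>R g + test2_t p e s t *\<^sub>R h))
    \<ge> - (p * (1 - damp e s) * norm g powr p)"
proof -
  note d = damp_bounds[OF e s] and H = excess_bounds[OF e s t]
  define a b x y W \<sigma> \<eta> \<kappa> where defs: "a = s + e" "b = t + e" "x = norm g" "y = norm h" "W = trunc e s powr p"
    "\<sigma> = damp e s" "\<eta> = excess e s t" "\<kappa> = excess' e s t"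
  have pos: "0 < a" "0 < b" "0 \<le> x" "0 \<le> y" "0 \<le> W" using e s t by (auto simp: defs)
  have f1: "norm g powr (p - 2) * (g \<bullet> h) \<le> x powr (p - 1) * y"
    using norm_flux(2)[OF p, of g h] unfolding defs by linarith
  have f2: "norm h powr (p - 2) * (h \<bullet> g) \<le> y powr (p - 1) * x"
    using norm_flux(2)[OF p, of h g] unfolding defs by linarith
  \<comment> \<open>These signs decide the direction in which the mixed terms can be estimated by
    Cauchy-Schwarz.\<close>
  have s1: "test1_t p e s t \<le> 0" "0 \<le> test2_s p e s t"
    using H d p e s t by (auto simp: test1_t_def test2_s_def)
  have "norm g powr (p - 2) * (g \<bullet> (test1_s p e s t *\<^sub>R g + test1_t p e s t *\<^sub>R h))
      = test1_s p e s t * x powr p + test1_t p e s t * (norm g powr (p - 2) * (g \<bullet> h))"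
    using norm_flux(1)[OF p, of g] unfolding defs by (simp add: inner_add_right algebra_simps)
  also have "\<dots> \<ge> test1_s p e s t * x powr p + test1_t p e s t * (x powr (p - 1) * y)"
    using mult_left_mono_neg[OF f1 s1(1)] by simp
  finally have 1: "test1_s p e s t * x powr p + test1_t p e s t * (x powr (p - 1) * y)
    \<le> norm g powr (p - 2) * (g \<bullet> (test1_s p e s t *\<^sub>R g + test1_t p e s t *\<^sub>R h))" .
  have "norm h powr (p - 2) * (h \<bullet> (test2_s p e s t *\<^sub>R g + test2_t p e s t *\<^sub>R h))
      = test2_s p e s t * (norm h powr (p - 2) * (h \<bullet> g)) + test2_t p e s t * y powr p"
    using norm_flux(1)[OF p, of h] unfolding defs by (simp add: inner_add_right algebra_simps)
  also have "\<dots> \<le> test2_s p e s t * (y powr (p - 1) * x) + test2_t p e s t * y powr p"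
    using mult_left_mono[OF f2 s1(2)] by simp
  finally have 2: "norm h powr (p - 2) * (h \<bullet> (test2_s p e s t *\<^sub>R g + test2_t p e s t *\<^sub>R h))
    \<le> test2_s p e s t * (y powr (p - 1) * x) + test2_t p e s t * y powr p" .
  have q: "(z / c) powr p = z powr p * (c powr (1 - p) / c)"
    "(z / c) powr (p - 1) = z powr (p - 1) * c powr (1 - p)" if "0 < c" "0 \<le> z" for z c :: real
  proof -
    have "c powr (1 - p) = c / c powr p" "c powr (p - 1) = c powr p / c"
      using that powr_diff[of c 1 p] powr_diff[of c p 1] by simp_all
    then show "(z / c) powr p = z powr p * (c powr (1 - p) / c)"
      "(z / c) powr (p - 1) = z powr (p - 1) * c powr (1 - p)"
      using that by (simp_all add: powr_divide)
  qed
  have P: "- (p * (1 - \<sigma>) * (x / a) powr p) \<le>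
      (\<sigma> * (p * \<eta> + \<kappa>) - (p - 1) * \<eta>) * (x / a) powr p - \<kappa> * ((x / a) powr (p - 1) * (y / b))
     - \<sigma> * (p * \<eta> + \<kappa>) * ((y / b) powr (p - 1) * (x / a)) + ((p - 1) * \<eta> + \<kappa>) * (y / b) powr p"
    by (rule picone_pointwise) (use pos p d H in \<open>auto simp: defs\<close>)
  \<comment> \<open>The powers of a and b in the test functions are absorbed by \<open>x / a\<close>
    and \<open>y / b\<close>, so \<open>W\<close> is the only remaining weight.\<close>
  have sum: "test1_s p e s t * x powr p + test1_t p e s t * (x powr (p - 1) * y)
     - (test2_s p e s t * (y powr (p - 1) * x) + test2_t p e s t * y powr p)
    = W * ((\<sigma> * (p * \<eta> + \<kappa>) - (p - 1) * \<eta>) * (x / a) powr p - \<kappa> * ((x / a) powr (p - 1) * (y / b))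
     - \<sigma> * (p * \<eta> + \<kappa>) * ((y / b) powr (p - 1) * (x / a)) + ((p - 1) * \<eta> + \<kappa>) * (y / b) powr p)"
    unfolding q[OF pos(1,3)] q[OF pos(2,4)] test1_s_def test1_t_def test2_s_def test2_t_def defs[symmetric]
    by (simp add: divide_inverse algebra_simps)
  \<comment> \<open>V \<le> a frees the error from the weight; what remains is |g|^p, which is
    integrable.\<close>
  have "W * (x / a) powr p \<le> x powr p"
  proof -
    have "W \<le> a powr p" unfolding defs using d p by (intro powr_mono2) auto
    then have "W * (x / a) powr p \<le> a powr p * (x / a) powr p" by (intro mult_right_mono) auto
    also have "\<dots> = x powr p" using pos by (simp add: powr_divide)
    finally show ?thesis .
  qed
  then have "p * (1 - \<sigma>) * (W * (x / a) powr p) \<le> p * (1 - \<sigma>) * x powr p"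
    using p d by (intro mult_left_mono) (auto simp: defs)
  moreover have "- (p * (1 - \<sigma>) * (W * (x / a) powr p)) \<le> W * ((\<sigma> * (p * \<eta> + \<kappa>) - (p - 1) * \<eta>) * (x / a) powr p - \<kappa> * ((x / a) powr (p - 1) * (y / b))
     - \<sigma> * (p * \<eta> + \<kappa>) * ((y / b) powr (p - 1) * (x / a)) + ((p - 1) * \<eta> + \<kappa>) * (y / b) powr p)"
    using mult_left_mono[OF P pos(5)] by (simp add: mult.left_commute mult.assoc)
  ultimately show ?thesis using 1 2 sum unfolding defs(3,6) by linarith
qed

section \<open>Comparison\<close>

lemma tendsto_test:
  assumes e: "e \<longlonglongrightarrow> 0" and s: "0 < s" and t: "0 < t"
  shows "(\<lambda>n::nat. damp (e n) s) \<longlonglongrightarrow> 1"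
    and "(\<lambda>n. test1 p (e n) s t) \<longlonglongrightarrow> s powr p * s powr (1 - p) * (max 0 (1 - t / s))\<^sup>2"
    and "(\<lambda>n. test2 p (e n) s t) \<longlonglongrightarrow> s powr p * t powr (1 - p) * (max 0 (1 - t / s))\<^sup>2"
proof -
  have "(\<lambda>n. damp (e n) s) \<longlonglongrightarrow> 1 / (1 + 0 * (s + 0))"
    unfolding damp_def by (intro tendsto_intros e) auto
  then show d: "(\<lambda>n. damp (e n) s) \<longlonglongrightarrow> 1" by simp
  have "(\<lambda>n. trunc (e n) s) \<longlonglongrightarrow> 1 * (s + 0)"
    unfolding trunc_def by (intro tendsto_intros e d)
  then have T: "(\<lambda>n. trunc (e n) s) \<longlonglongrightarrow> s" by simp
  have "(\<lambda>n. ratio (e n) s t) \<longlonglongrightarrow> (t + 0) * (0 + 1 / (s + 0))"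
    unfolding ratio_def using s by (intro tendsto_intros e) auto
  then have r: "(\<lambda>n. ratio (e n) s t) \<longlonglongrightarrow> t / s" by simp
  have sh: "(\<lambda>n. s + e n) \<longlonglongrightarrow> s" "(\<lambda>n. t + e n) \<longlonglongrightarrow> t"
    using tendsto_add[OF tendsto_const e, of s] tendsto_add[OF tendsto_const e, of t] by simp_all
  show "(\<lambda>n. test1 p (e n) s t) \<longlonglongrightarrow> s powr p * s powr (1 - p) * (max 0 (1 - t / s))\<^sup>2"
    "(\<lambda>n. test2 p (e n) s t) \<longlonglongrightarrow> s powr p * t powr (1 - p) * (max 0 (1 - t / s))\<^sup>2"
    unfolding test1_def test2_def excess_def using s t
    by (intro tendsto_mult tendsto_powr tendsto_power tendsto_max tendsto_diff tendsto_const T sh r; simp)+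
qed

lemma p_laplace_comparison:
  assumes S1: "p_laplace_solution p \<Omega> f1 v1 g1" and S2: "p_laplace_solution p \<Omega> f2 v2 g2"
    and strict: "AE x in lebesgue_on \<Omega>. v2 x < v1 x \<longrightarrow> f1 x * v1 x powr (1 - p) < f2 x * v2 x powr (1 - p)"
  shows "AE x in lebesgue_on \<Omega>. v1 x \<le> v2 x"
proof -
  interpret S1: p_laplace_solution p \<Omega> f1 v1 g1 by (rule S1)
  interpret S2: p_laplace_solution p \<Omega> f2 v2 g2 by (rule S2)
  let ?M = "lebesgue_on \<Omega>"
  note p = S1.p_gt_1
  obtain \<phi> where \<phi>: "dom_approx p \<Omega> \<phi> v1 g1"
    using W0_dom_approx[OF S1.open_domain S1.bounded_domain p S1.W0 S1.pos] .
  obtain \<psi> where \<psi>: "dom_approx p \<Omega> \<psi> v2 g2"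
    using W0_dom_approx[OF S1.open_domain S1.bounded_domain p S2.W0 S2.pos] .
  note [measurable] = S1.v_measurable S2.v_measurable S1.source_measurable S2.source_measurable S1.g_measurable
  define e where "e n = inverse (real (Suc n))" for n
  have e: "0 < e n" "e \<longlonglongrightarrow> 0" for n unfolding e_def using LIMSEQ_inverse_real_of_nat by auto
  have p0: "0 < p" using p by simp
  note A1 = dom_approx_comp[OF C1_quadrant_test(1)[OF e(1) p] \<phi> \<psi> p0]
    and A2 = dom_approx_comp[OF C1_quadrant_test(2)[OF e(1) p] \<phi> \<psi> p0]
  note nn = dom_approxD(2)[OF \<phi>] dom_approxD(2)[OF \<psi>]
  define a b where "a n x = test1 p (e n) (v1 x) (v2 x)" and "b n x = test2 p (e n) (v1 x) (v2 x)" for n x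
  define J1 where "J1 n x = norm (g1 x) powr (p - 2) * (g1 x \<bullet>
      (test1_s p (e n) (v1 x) (v2 x) *\<^sub>R g1 x + test1_t p (e n) (v1 x) (v2 x) *\<^sub>R g2 x))" for n x
  define J2 where "J2 n x = norm (g2 x) powr (p - 2) * (g2 x \<bullet>
      (test2_s p (e n) (v1 x) (v2 x) *\<^sub>R g1 x + test2_t p (e n) (v1 x) (v2 x) *\<^sub>R g2 x))" for n x
  have J1i: "integrable ?M (J1 n)" for n
    unfolding J1_def by (rule dom_approx_flux(1)[OF A1 p S1.open_domain S1.g_measurable S1.g_powr_integrable])
  have J2i: "integrable ?M (J2 n)" for n
    unfolding J2_def by (rule dom_approx_flux(1)[OF A2 p S1.open_domain S2.g_measurable S2.g_powr_integrable])
  have fa: "integrable ?M (\<lambda>x. f1 x * a n x)" for n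
    unfolding a_def by (rule S1.integral_source_le(1)[OF A1])
  have fb: "integrable ?M (\<lambda>x. f2 x * b n x)" for n
    unfolding b_def by (rule S2.integral_source_le(1)[OF A2])
  have fv: "integrable ?M (\<lambda>x. f1 x * v1 x)" by (rule S1.integral_source_le(1)[OF \<phi>])
  \<comment> \<open>\<open>test_bounds(3)\<close> gives the required order at the level of the
    approximants \<open>\<phi> k\<close>, \<open>\<psi> k\<close>.\<close>
  have ge: "(\<integral>x. J1 n x \<partial>?M) \<le> (\<integral>x. f1 x * a n x \<partial>?M)" for n
    unfolding a_def J1_def by (rule S1.integral_source_ge[OF \<phi> A1 test_bounds(3)[OF e(1) nn p]])
  have le: "(\<integral>x. f2 x * b n x \<partial>?M) \<le> (\<integral>x. J2 n x \<partial>?M)" for n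
    unfolding b_def J2_def by (rule S2.integral_source_le(2)[OF A2])
  \<comment> \<open>The truncation error: dominated by p |grad v1|^p and tending to 0 a.e. because
    \<open>damp\<close> tends to 1.\<close>
  define d where "d n x = p * (1 - damp (e n) (v1 x)) * norm (g1 x) powr p" for n x
  have dm: "d n \<in> borel_measurable ?M" for n unfolding d_def by measurable
  have db: "AE x in ?M. norm (d n x) \<le> p * norm (g1 x) powr p" for n
    using S1.pos
  proof eventually_elim
    case (elim x)
    then have "0 < damp (e n) (v1 x)" "damp (e n) (v1 x) \<le> 1" using damp_bounds[OF e(1)] by auto
    then have "p * (1 - damp (e n) (v1 x)) \<le> p" "0 \<le> d n x" using p by (auto simp: d_def)
    then show ?case unfolding d_def by (simp add: mult_right_mono)
  qed
  have dl: "AE x in ?M. (\<lambda>n. d n x) \<longlonglongrightarrow> 0"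
    using S1.pos
  proof eventually_elim
    case (elim x)
    have "(\<lambda>n. d n x) \<longlonglongrightarrow> p * (1 - 1) * norm (g1 x) powr p"
      unfolding d_def by (intro tendsto_intros tendsto_test(1)[OF e(2) elim zero_less_one])
    then show ?case by simp
  qed
  have w: "integrable ?M (\<lambda>x. p * norm (g1 x) powr p)" using S1.g_powr_integrable by simp
  have di: "integrable ?M (d n)" for n
    by (rule integrable_dominated_convergence2[OF _ dm w dl db]) simp
  have "(\<lambda>n. \<integral>x. d n x \<partial>?M) \<longlonglongrightarrow> (\<integral>x. 0 \<partial>?M)"
    by (rule integral_dominated_convergence[OF _ dm w dl db]) simp
  then have c: "(\<lambda>n. (\<integral>x. f1 x * v1 x \<partial>?M) + (\<integral>x. d n x \<partial>?M)) \<longlonglongrightarrow> (\<integral>x. f1 x * v1 x \<partial>?M)"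
    using tendsto_add[OF tendsto_const, of _ 0] by fastforce
  have picone: "- (\<integral>x. d n x \<partial>?M) \<le> (\<integral>x. J1 n x \<partial>?M) - (\<integral>x. J2 n x \<partial>?M)" for n
  proof -
    have "(\<integral>x. - d n x \<partial>?M) \<le> (\<integral>x. J1 n x - J2 n x \<partial>?M)"
    proof (rule integral_mono_AE)
      show "AE x in ?M. - d n x \<le> J1 n x - J2 n x"
        using S1.pos S2.pos
      proof eventually_elim
        case (elim x)
        then show ?case unfolding d_def J1_def J2_def by (intro picone_test e(1) p) auto
      qed
    qed (use di J1i J2i in auto)
    then show ?thesis using J1i J2i by simp
  qed
  define H where "H x = (max 0 (1 - v2 x / v1 x))\<^sup>2" for x
  define L where "L x = f1 x * (v1 x powr p * v1 x powr (1 - p) * H x) - f2 x * (v1 x powr p * v2 x powr (1 - p) * H x)" for x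
  have Fi: "integrable ?M (\<lambda>x. f1 x * v1 x - (f1 x * a n x - f2 x * b n x))" for n
    by (intro Bochner_Integration.integrable_diff fv fa fb)
  \<comment> \<open>Adding the integrable \<open>f1 x * v1 x\<close> makes the integrands
    nonnegative, since a_n \<le> v1 and b_n \<ge> 0. Thus Fatou applies although no majorant for
    \<open>f2 x * b n x\<close> is at hand.\<close>
  have F0: "AE x in ?M. 0 \<le> f1 x * v1 x - (f1 x * a n x - f2 x * b n x)" for n
    using S1.pos S2.pos S1.source_nonneg S2.source_nonneg
  proof eventually_elim
    case (elim x)
    then have "a n x \<le> v1 x" "0 \<le> b n x"
      unfolding a_def b_def using test_bounds(2,3)[OF e(1) _ _ p] by auto
    with elim have "f1 x * a n x \<le> f1 x * v1 x" "0 \<le> f2 x * b n x" by (auto intro: mult_left_mono)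
    then show ?case by linarith
  qed
  have Fm: "(\<lambda>x. f1 x * v1 x - L x) \<in> borel_measurable ?M"
    unfolding L_def H_def by measurable
  have Fl: "AE x in ?M. (\<lambda>n. f1 x * v1 x - (f1 x * a n x - f2 x * b n x)) \<longlonglongrightarrow> f1 x * v1 x - L x"
    using S1.pos S2.pos
  proof eventually_elim
    case (elim x)
    then show ?case unfolding L_def H_def a_def b_def
      by (intro tendsto_diff tendsto_mult[OF tendsto_const] tendsto_const tendsto_test[OF e(2)])
  qed
  \<comment> \<open>The source integral is bounded below for \<open>a\<close> and above for
    \<open>b\<close>, so \<open>ge\<close>, \<open>le\<close> and \<open>picone\<close> chain in one
    direction.\<close>
  have Fb: "(\<integral>x. f1 x * v1 x - (f1 x * a n x - f2 x * b n x) \<partial>?M) \<le> (\<integral>x. f1 x * v1 x \<partial>?M) + (\<integral>x. d n x \<partial>?M)" for n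
    using picone[of n] ge[of n] le[of n] fv fa[of n] fb[of n] by simp
  note F = fatou_le[OF Fi F0 Fm Fl Fb c]
  have "integrable ?M (\<lambda>x. f1 x * v1 x - (f1 x * v1 x - L x))"
    by (rule Bochner_Integration.integrable_diff[OF fv F(1)])
  then have Li: "integrable ?M (\<lambda>x. - L x)" by simp
  have L_eq: "L x = v1 x powr p * H x * (f1 x * v1 x powr (1 - p) - f2 x * v2 x powr (1 - p))" for x
    unfolding L_def by (simp add: algebra_simps)
  have H_eq: "H x = 0 \<or> v2 x < v1 x" if "0 < v1 x" for x
    using that by (auto simp: H_def max_def divide_simps)
  have L0: "AE x in ?M. 0 \<le> - L x"
    using S1.pos strict
  proof eventually_elim
    case (elim x)
    show ?case
    proof (cases "v2 x < v1 x")
      case True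
      have "0 \<le> H x" by (simp add: H_def)
      then show ?thesis unfolding L_eq using elim True by (simp add: mult_nonneg_nonpos)
    next
      case False
      then show ?thesis using H_eq[OF elim(1)] unfolding L_eq by simp
    qed
  qed
  \<comment> \<open>Cancelling the finite integral of \<open>f1 x * v1 x\<close> in Fatou's bound
    leaves a nonnegative function with nonpositive integral.\<close>
  have "(\<integral>x. - L x \<partial>?M) \<le> 0"
    using F(2) fv Li by simp
  with integral_nonneg_AE[OF L0] have "(\<integral>x. - L x \<partial>?M) = 0" by linarith
  then have "AE x in ?M. - L x = 0"
    using integral_nonneg_eq_0_iff_AE[OF Li L0] by blast
  then show ?thesis
    using S1.pos strict
  proof eventually_elim
    case (elim x)
    show ?case
    proof (rule ccontr)
      assume n: "\<not> v1 x \<le> v2 x"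
      then have "0 < H x" using elim(2) by (simp add: H_def)
      moreover have "0 < v1 x powr p" using elim(2) by simp
      ultimately have "f1 x * v1 x powr (1 - p) - f2 x * v2 x powr (1 - p) = 0"
        using elim(1) unfolding L_eq by auto
      with elim(3) n show False by simp
    qed
  qed
qed

section \<open>Return to the Caratheodory nonlinearities\<close>

lemma weak_solution_imp_p_laplace_solution:
  assumes "open \<Omega>" "bounded \<Omega>" "1 < p" "caratheodory \<Omega> G" "weak_solution p \<Omega> G v"
  obtains g where "p_laplace_solution p \<Omega> (\<lambda>x. G x (v x)) v g"
proof -
  obtain g where g: "W0 p \<Omega> v g" "AE x in lebesgue_on \<Omega>. v x > 0"
    "\<forall>K. compact K \<and> K \<subseteq> \<Omega> \<longrightarrow> integrable (lebesgue_on K) (\<lambda>x. G x (v x))"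
    "\<forall>\<phi>. Cc1 \<Omega> \<phi> \<longrightarrow>
           (\<integral>x. norm (g x) powr (p - 2) * (g x \<bullet> grad \<phi> x) \<partial>lebesgue_on \<Omega>) =
           (\<integral>x. G x (v x) * \<phi> x \<partial>lebesgue_on \<Omega>)"
    using assms(5) unfolding weak_solution_def by (elim exE conjE) (rule that)
  have G: "\<And>x s. x \<in> \<Omega> \<Longrightarrow> 0 < s \<Longrightarrow> 0 \<le> G x s" using assms(4) unfolding caratheodory_def by simp
  have "AE x in lebesgue_on \<Omega>. 0 \<le> G x (v x)"
    using g(2) AE_space by eventually_elim (simp add: G)
  then have "p_laplace_solution p \<Omega> (\<lambda>x. G x (v x)) v g"
    using assms(1-3) g by unfold_locales simp_all
  then show thesis by (rule that)
qed

theorem mainTheorem1: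
  fixes \<Omega> :: "'a::euclidean_space set"
    and p :: real
    and G1 G2 :: "'a \<Rightarrow> real \<Rightarrow> real"
    and v1 v2 :: "'a \<Rightarrow> real"
  assumes "open \<Omega>" and "bounded \<Omega>"
    and "1 < p" and "p < real DIM('a)"
    and "caratheodory \<Omega> G1" and "caratheodory \<Omega> G2"
    and "AE x in lebesgue_on \<Omega>. \<forall>s>0. G1 x s \<le> G2 x s"
    and "(AE x in lebesgue_on \<Omega>. \<forall>s t. 0 < s \<and> s < t \<longrightarrow>
             G1 x t * t powr (1 - p) < G1 x s * s powr (1 - p))
       \<or> (AE x in lebesgue_on \<Omega>. \<forall>s t. 0 < s \<and> s < t \<longrightarrow>
             G2 x t * t powr (1 - p) < G2 x s * s powr (1 - p))"
    and "weak_solution p \<Omega> G1 v1"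
    and "weak_solution p \<Omega> G2 v2"
  shows "AE x in lebesgue_on \<Omega>. v1 x \<le> v2 x"
proof -
  obtain g1 where S1: "p_laplace_solution p \<Omega> (\<lambda>x. G1 x (v1 x)) v1 g1"
    using weak_solution_imp_p_laplace_solution[OF assms(1-3,5,9)] .
  obtain g2 where S2: "p_laplace_solution p \<Omega> (\<lambda>x. G2 x (v2 x)) v2 g2"
    using weak_solution_imp_p_laplace_solution[OF assms(1-3,6,10)] .
  note pos = p_laplace_solution.pos[OF S1] p_laplace_solution.pos[OF S2]
  have "AE x in lebesgue_on \<Omega>. v2 x < v1 x \<longrightarrow>
      G1 x (v1 x) * v1 x powr (1 - p) < G2 x (v2 x) * v2 x powr (1 - p)"
    using assms(8)
  proof
    assume "AE x in lebesgue_on \<Omega>. \<forall>s t. 0 < s \<and> s < t \<longrightarrow>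
        G1 x t * t powr (1 - p) < G1 x s * s powr (1 - p)"
    then show ?thesis using assms(7) pos
    proof eventually_elim
      case (elim x)
      \<comment> \<open>G1 decides the passage from v1 to v2 strictly, so the two nonlinearities are
        compared at v2.\<close>
      have "G1 x (v2 x) * v2 x powr (1 - p) \<le> G2 x (v2 x) * v2 x powr (1 - p)"
        using elim by (intro mult_right_mono) auto
      with elim show ?case by (meson less_le_trans)
    qed
  next
    assume "AE x in lebesgue_on \<Omega>. \<forall>s t. 0 < s \<and> s < t \<longrightarrow>
        G2 x t * t powr (1 - p) < G2 x s * s powr (1 - p)"
    then show ?thesis using assms(7) pos
    proof eventually_elim
      case (elim x)
      \<comment> \<open>Here the strict passage from v1 to v2 takes place along G2, so the
        comparison is made at v1.\<close>
      have "G1 x (v1 x) * v1 x powr (1 - p) \<le> G2 x (v1 x) * v1 x powr (1 - p)"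
        using elim by (intro mult_right_mono) auto
      with elim show ?case by (meson le_less_trans)
    qed
  qed
  with S1 S2 show ?thesis by (rule p_laplace_comparison)
qed

end
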